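(* Let $R$ be a complete local Noetherian (commutative) ring, $L$ an arbitrary $R$-module, and $S\subseteq L$ a subset. Then, as submodule selectors on Matlis-dualizable $R$-modules, $\operatorname{tr}_{S,L}^{\smile}=\operatorname{tom}_{S,L}$; that is, for every Matlis-dualizable $R$-module $M$, $\operatorname{tr}_{S,L}^{\smile}(M)=\operatorname{tom}_{S,L}(M)$ as submodules of $M$.
   Context: Let $E$ be the injective hull of the residue field of $R$ and $(-)^\vee=\operatorname{Hom}_R(-,E)$. A module $M$ is Matlis-dualizable if the natural map $M\to M^{\vee\vee}$ is an isomorphism; $M$ and $M^{\vee\vee}$ are identified. For an $R$-module $N$, $\operatorname{tr}_{S,L}(N)$ is the $R$-submodule of $N$ generated by $\{f(s)\mid f\in\operatorname{Hom}_R(L,N),\ s\in S\}$. The module torsion with respect to $S\subseteq L$ is $\operatorname{tom}_{S,L}(M):=\{z\in M\mid s\otimes z=0\text{ in }L\otimes_RM\text{ for all }s\in S\}$. For a submodule selector $\alpha$ (an isomorphism-compatible assignment of a submodule $\alpha(M)\subseteq M$ to each module $M$ in a class), its smile dual is $\alpha^{\smile}(M):=(M^\vee/\alpha(M^\vee))^\vee$, regarded as a submodule of $M\cong M^{\vee\vee}$ via the dual of the quotient map $M^\vee\to M^\vee/\alpha(M^\vee)$. *)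

theory Defs
  imports "HOL-Algebra.Module" "HOL-Algebra.QuotRing" "HOL-Algebra.Ideal_Product"
    "HOL-Algebra.Ring_Divisibility"
begin

section \<open>Linear maps, quotients and Hom modules\<close>

definition mod_hom ::
  "('a, 'z) ring_scheme \<Rightarrow> ('a, 'm, 'y) module_scheme \<Rightarrow> ('a, 'n, 'w) module_scheme \<Rightarrow> ('m \<Rightarrow> 'n) set"
where
  "mod_hom R M N = {f \<in> carrier M \<rightarrow> carrier N.
     (\<forall>x\<in>carrier M. \<forall>y\<in>carrier M. f (x \<oplus>\<^bsub>M\<^esub> y) = f x \<oplus>\<^bsub>N\<^esub> f y) \<and>
     (\<forall>r\<in>carrier R. \<forall>x\<in>carrier M. f (r \<odot>\<^bsub>M\<^esub> x) = r \<odot>\<^bsub>N\<^esub> f x)}"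

definition mod_iso ::
  "('a, 'z) ring_scheme \<Rightarrow> ('a, 'm, 'y) module_scheme \<Rightarrow> ('a, 'n, 'w) module_scheme \<Rightarrow> ('m \<Rightarrow> 'n) set"
where
  "mod_iso R M N = {f \<in> mod_hom R M N. bij_betw f (carrier M) (carrier N)}"

definition submodule_span ::
  "('a, 'z) ring_scheme \<Rightarrow> ('a, 'm, 'y) module_scheme \<Rightarrow> 'm set \<Rightarrow> 'm set"
where
  "submodule_span R M A = (\<lambda>N. submodule N R M) hull A"

text \<open>The record type of modules extends that of rings; the fields \<open>mult\<close> and \<open>one\<close> play no role
  for modules and are left unspecified in the constructions below.\<close>

definition ring_module :: "('a, 'z) ring_scheme \<Rightarrow> ('a, 'a) module" where
  "ring_module R = \<lparr>carrier = carrier R, monoid.mult = (\<lambda>_ _. undefined), one = undefined,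
     zero = \<zero>\<^bsub>R\<^esub>, add = add R, smult = monoid.mult R\<rparr>"

definition quotient_module :: "('a, 'm, 'y) module_scheme \<Rightarrow> 'm set \<Rightarrow> ('a, 'm set) module" where
  "quotient_module M N = \<lparr>carrier = a_rcosets\<^bsub>M\<^esub> N, monoid.mult = (\<lambda>_ _. undefined), one = undefined,
     zero = N, add = set_add M, smult = (\<lambda>r C. \<Union>x\<in>C. N +>\<^bsub>M\<^esub> (r \<odot>\<^bsub>M\<^esub> x))\<rparr>"

text \<open>Elements of the Hom module are required to be extensional, so that equality in the
  carrier is equality of maps on \<open>carrier M\<close>.\<close>

definition hom_module ::
  "('a, 'z) ring_scheme \<Rightarrow> ('a, 'm, 'y) module_scheme \<Rightarrow> ('a, 'n, 'w) module_scheme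
    \<Rightarrow> ('a, 'm \<Rightarrow> 'n) module"
where
  "hom_module R M N = \<lparr>carrier = mod_hom R M N \<inter> extensional (carrier M),
     monoid.mult = (\<lambda>_ _. undefined), one = undefined,
     zero = (\<lambda>x\<in>carrier M. \<zero>\<^bsub>N\<^esub>),
     add = (\<lambda>f g. \<lambda>x\<in>carrier M. f x \<oplus>\<^bsub>N\<^esub> g x),
     smult = (\<lambda>r f. \<lambda>x\<in>carrier M. r \<odot>\<^bsub>N\<^esub> f x)\<rparr>"


section \<open>Tensor products\<close>

definition free_module :: "('a, 'z) ring_scheme \<Rightarrow> 'x set \<Rightarrow> ('a, 'x \<Rightarrow> 'a) module" where
  "free_module R B = \<lparr>carrier = {c. (\<forall>x. c x \<in> carrier R) \<and> (\<forall>x. x \<notin> B \<longrightarrow> c x = \<zero>\<^bsub>R\<^esub>)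
                                     \<and> finite {x. c x \<noteq> \<zero>\<^bsub>R\<^esub>}},
     monoid.mult = (\<lambda>_ _. undefined), one = undefined,
     zero = (\<lambda>x. \<zero>\<^bsub>R\<^esub>),
     add = (\<lambda>c d x. c x \<oplus>\<^bsub>R\<^esub> d x),
     smult = (\<lambda>r c x. r \<otimes>\<^bsub>R\<^esub> c x)\<rparr>"

definition free_gen :: "('a, 'z) ring_scheme \<Rightarrow> 'x \<Rightarrow> 'x \<Rightarrow> 'a" where
  "free_gen R x = (\<lambda>y. if y = x then \<one>\<^bsub>R\<^esub> else \<zero>\<^bsub>R\<^esub>)"

definition tensor_relations ::
  "('a, 'z) ring_scheme \<Rightarrow> ('a, 'l, 'y) module_scheme \<Rightarrow> ('a, 'm, 'w) module_scheme
    \<Rightarrow> ('l \<times> 'm \<Rightarrow> 'a) set"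
where
  "tensor_relations R L M = (let F = free_module R (carrier L \<times> carrier M); e = free_gen R in
     {e (l \<oplus>\<^bsub>L\<^esub> l', x) \<ominus>\<^bsub>F\<^esub> (e (l, x) \<oplus>\<^bsub>F\<^esub> e (l', x)) | l l' x.
        l \<in> carrier L \<and> l' \<in> carrier L \<and> x \<in> carrier M} \<union>
     {e (l, x \<oplus>\<^bsub>M\<^esub> x') \<ominus>\<^bsub>F\<^esub> (e (l, x) \<oplus>\<^bsub>F\<^esub> e (l, x')) | l x x'.
        l \<in> carrier L \<and> x \<in> carrier M \<and> x' \<in> carrier M} \<union>
     {e (r \<odot>\<^bsub>L\<^esub> l, x) \<ominus>\<^bsub>F\<^esub> r \<odot>\<^bsub>F\<^esub> e (l, x) | r l x.
        r \<in> carrier R \<and> l \<in> carrier L \<and> x \<in> carrier M} \<union>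
     {e (l, r \<odot>\<^bsub>M\<^esub> x) \<ominus>\<^bsub>F\<^esub> r \<odot>\<^bsub>F\<^esub> e (l, x) | r l x.
        r \<in> carrier R \<and> l \<in> carrier L \<and> x \<in> carrier M})"

definition tensor_null ::
  "('a, 'z) ring_scheme \<Rightarrow> ('a, 'l, 'y) module_scheme \<Rightarrow> ('a, 'm, 'w) module_scheme
    \<Rightarrow> ('l \<times> 'm \<Rightarrow> 'a) set"
where
  "tensor_null R L M =
     submodule_span R (free_module R (carrier L \<times> carrier M)) (tensor_relations R L M)"

definition tensor_product ::
  "('a, 'z) ring_scheme \<Rightarrow> ('a, 'l, 'y) module_scheme \<Rightarrow> ('a, 'm, 'w) module_scheme
    \<Rightarrow> ('a, ('l \<times> 'm \<Rightarrow> 'a) set) module"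
where
  "tensor_product R L M =
     quotient_module (free_module R (carrier L \<times> carrier M)) (tensor_null R L M)"

definition pure_tensor ::
  "('a, 'z) ring_scheme \<Rightarrow> ('a, 'l, 'y) module_scheme \<Rightarrow> ('a, 'm, 'w) module_scheme
    \<Rightarrow> 'l \<Rightarrow> 'm \<Rightarrow> ('l \<times> 'm \<Rightarrow> 'a) set"
where
  "pure_tensor R L M l x =
     tensor_null R L M +>\<^bsub>free_module R (carrier L \<times> carrier M)\<^esub> free_gen R (l, x)"


section \<open>Complete local rings\<close>

definition local_ring :: "('a, 'z) ring_scheme \<Rightarrow> bool" where
  "local_ring R \<longleftrightarrow> cring R \<and> (\<exists>!I. maximalideal I R)"

definition max_ideal :: "('a, 'z) ring_scheme \<Rightarrow> 'a set" where
  "max_ideal R = (THE I. maximalideal I R)"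

definition residue_field :: "('a, 'z) ring_scheme \<Rightarrow> ('a, 'a set) module" where
  "residue_field R = quotient_module (ring_module R) (max_ideal R)"

text \<open>The canonical map from \<open>R\<close> to the inverse limit of the rings \<open>R / I\<^sup>n\<close> is bijective
  (in particular, the \<open>I\<close>-adic topology is separated). The transition map
  \<open>R / I\<^sup>n\<^sup>+\<^sup>1 \<rightarrow> R / I\<^sup>n\<close> sends a coset \<open>C\<close> to \<open>I\<^sup>n + C\<close>.\<close>

definition adic_limit :: "('a, 'z) ring_scheme \<Rightarrow> 'a set \<Rightarrow> (nat \<Rightarrow> 'a set) set" where
  "adic_limit R I = {c. (\<forall>n. c n \<in> carrier (R Quot (I [^]\<^bsub>ideals_set R\<^esub> n))) \<and>
     (\<forall>n. (I [^]\<^bsub>ideals_set R\<^esub> n) <+>\<^bsub>R\<^esub> c (Suc n) = c n)}"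

definition adic_complete :: "('a, 'z) ring_scheme \<Rightarrow> 'a set \<Rightarrow> bool" where
  "adic_complete R I \<longleftrightarrow>
     bij_betw (\<lambda>x n. (I [^]\<^bsub>ideals_set R\<^esub> n) +>\<^bsub>R\<^esub> x) (carrier R) (adic_limit R I)"


section \<open>Injective hulls\<close>

text \<open>The lifting property is tested on modules whose carriers live in the type \<open>'x\<close>. The universe
  \<open>'x = 'a\<close> of the ring itself suffices: see \<open>injective_module_universe\<close> below.\<close>

definition injective_module ::
  "'x itself \<Rightarrow> ('a, 'z) ring_scheme \<Rightarrow> ('a, 'e, 'y) module_scheme \<Rightarrow> bool"
where
  "injective_module T R E \<longleftrightarrow> module R E \<and>
     (\<forall>(A :: ('a, 'x) module) (B :: ('a, 'x) module) i f.
        module R A \<and> module R B \<and> i \<in> mod_hom R A B \<and> inj_on i (carrier A) \<and> f \<in> mod_hom R A E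
        \<longrightarrow> (\<exists>g \<in> mod_hom R B E. \<forall>x\<in>carrier A. g (i x) = f x))"

lemma mod_homD:
  assumes "f \<in> mod_hom R M N"
  shows "x \<in> carrier M \<Longrightarrow> f x \<in> carrier N"
    and "x \<in> carrier M \<Longrightarrow> y \<in> carrier M \<Longrightarrow> f (x \<oplus>\<^bsub>M\<^esub> y) = f x \<oplus>\<^bsub>N\<^esub> f y"
    and "r \<in> carrier R \<Longrightarrow> x \<in> carrier M \<Longrightarrow> f (r \<odot>\<^bsub>M\<^esub> x) = r \<odot>\<^bsub>N\<^esub> f x"
  using assms by (auto simp: mod_hom_def)

lemma injective_module_lift:
  fixes A B :: "('a, 'x) module"
  assumes "injective_module TYPE('x) R E" "module R A" "module R B"
    and "i \<in> mod_hom R A B" "inj_on i (carrier A)" "f \<in> mod_hom R A E"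
  obtains g where "g \<in> mod_hom R B E" "\<And>x. x \<in> carrier A \<Longrightarrow> g (i x) = f x"
  using assms unfolding injective_module_def by metis

lemma ideal_module:
  assumes "cring R" and "ideal I R"
  shows "module R ((ring_module R)\<lparr>carrier := I\<rparr>)"
proof -
  interpret cring R by fact
  interpret I: ideal I R by fact
  note sub = I.Icarr
  show ?thesis
  proof (rule moduleI)
    show "abelian_group ((ring_module R)\<lparr>carrier := I\<rparr>)"
    proof (rule abelian_groupI)
      fix x assume "x \<in> carrier ((ring_module R)\<lparr>carrier := I\<rparr>)"
      then have "\<ominus>\<^bsub>R\<^esub> x \<in> I" "\<ominus>\<^bsub>R\<^esub> x \<oplus>\<^bsub>R\<^esub> x = \<zero>\<^bsub>R\<^esub>"
        by (auto simp: ring_module_def I.a_inv_closed sub l_neg)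
      then show "\<exists>y\<in>carrier ((ring_module R)\<lparr>carrier := I\<rparr>).
          y \<oplus>\<^bsub>(ring_module R)\<lparr>carrier := I\<rparr>\<^esub> x = \<zero>\<^bsub>(ring_module R)\<lparr>carrier := I\<rparr>\<^esub>"
        by (auto simp: ring_module_def)
    qed (auto simp: ring_module_def sub a_ac)
  qed (auto simp: ring_module_def sub I.I_l_closed l_distr r_distr m_assoc intro: cring_axioms)
qed

text \<open>Baer's criterion: lifting along inclusions of ideals of \<open>R\<close>, which is contained in the
  lifting property over the universe of \<open>R\<close>, gives the lifting property over every universe.\<close>

lemma injective_module_universe:
  fixes R :: "('a, 'z) ring_scheme" and E :: "('a, 'e, 'y) module_scheme"
  assumes inj: "injective_module TYPE('a) R E"
  shows "injective_module TYPE('x) R E"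
proof -
  have E: "module R E" using inj by (simp add: injective_module_def)
  interpret R: cring R using E by (rule module.axioms(1))
  interpret E: module R E by fact
  have "\<exists>g \<in> mod_hom R B E. \<forall>x\<in>carrier A. g (i x) = f x"
    if A: "module R A" and B: "module R B" and i: "i \<in> mod_hom R A B"
      and inj_i: "inj_on i (carrier A)" and f: "f \<in> mod_hom R A E"
    for A B :: "('a, 'x) module" and i f
  proof -
    interpret A: module R A by fact
    interpret B: module R B by fact
    note iD = mod_homD[OF i] and fD = mod_homD[OF f]
    define base where "base = {(i a, f a) | a. a \<in> carrier A}"
    define P where "P G \<longleftrightarrow> G \<subseteq> carrier B \<times> carrier E \<and> base \<subseteq> G \<and>
      (\<forall>e. (\<zero>\<^bsub>B\<^esub>, e) \<in> G \<longrightarrow> e = \<zero>\<^bsub>E\<^esub>) \<and>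
      (\<forall>x e y d. (x, e) \<in> G \<and> (y, d) \<in> G \<longrightarrow> (x \<oplus>\<^bsub>B\<^esub> y, e \<oplus>\<^bsub>E\<^esub> d) \<in> G) \<and>
      (\<forall>r\<in>carrier R. \<forall>x e. (x, e) \<in> G \<longrightarrow> (r \<odot>\<^bsub>B\<^esub> x, r \<odot>\<^bsub>E\<^esub> e) \<in> G)" for G
    have i0: "i \<zero>\<^bsub>A\<^esub> = \<zero>\<^bsub>B\<^esub>"
      using iD(3)[of "\<zero>\<^bsub>R\<^esub>" "\<zero>\<^bsub>A\<^esub>"] iD(1)[of "\<zero>\<^bsub>A\<^esub>"] by simp
    have f0: "f \<zero>\<^bsub>A\<^esub> = \<zero>\<^bsub>E\<^esub>"
      using fD(3)[of "\<zero>\<^bsub>R\<^esub>" "\<zero>\<^bsub>A\<^esub>"] fD(1)[of "\<zero>\<^bsub>A\<^esub>"] by simp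
    have Pbase: "P base"
      unfolding P_def
    proof (intro conjI allI impI ballI)
      show "base \<subseteq> carrier B \<times> carrier E" "base \<subseteq> base" by (auto simp: base_def iD(1) fD(1))
      show "e = \<zero>\<^bsub>E\<^esub>" if "(\<zero>\<^bsub>B\<^esub>, e) \<in> base" for e
      proof -
        obtain a where a: "a \<in> carrier A" "i a = \<zero>\<^bsub>B\<^esub>" "e = f a"
          using \<open>(\<zero>\<^bsub>B\<^esub>, e) \<in> base\<close> by (auto simp: base_def)
        then have "a = \<zero>\<^bsub>A\<^esub>" using inj_i i0 by (metis A.zero_closed inj_onD)
        then show ?thesis using a f0 by simp
      qed
      show "(x \<oplus>\<^bsub>B\<^esub> y, e \<oplus>\<^bsub>E\<^esub> d) \<in> base" if "(x, e) \<in> base \<and> (y, d) \<in> base" for x e y d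
        using that unfolding base_def
        by (clarsimp) (metis A.add.m_closed iD(2) fD(2))
      show "(r \<odot>\<^bsub>B\<^esub> x, r \<odot>\<^bsub>E\<^esub> e) \<in> base" if "r \<in> carrier R" "(x, e) \<in> base" for r x e
        using that unfolding base_def
        by (clarsimp) (metis A.smult_closed iD(3) fD(3))
    qed
    have "\<exists>G\<in>Collect P. \<forall>H\<in>Collect P. G \<subseteq> H \<longrightarrow> H = G"
    proof (rule subset_Zorn_nonempty)
      show "Collect P \<noteq> {}" using Pbase by blast
      fix C assume ne: "C \<noteq> {}" and ch: "subset.chain (Collect P) C"
      have CP: "\<And>G. G \<in> C \<Longrightarrow> P G" and
        tot: "\<And>G H. G \<in> C \<Longrightarrow> H \<in> C \<Longrightarrow> G \<subseteq> H \<or> H \<subseteq> G"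
        using ch by (auto simp: subset_chain_def)
      have "P (\<Union>C)"
        unfolding P_def
      proof (intro conjI allI impI ballI)
        show "\<Union>C \<subseteq> carrier B \<times> carrier E" "base \<subseteq> \<Union>C"
          using CP ne unfolding P_def by blast+
        show "e = \<zero>\<^bsub>E\<^esub>" if "(\<zero>\<^bsub>B\<^esub>, e) \<in> \<Union>C" for e
          using that CP unfolding P_def by blast
        show "(r \<odot>\<^bsub>B\<^esub> x, r \<odot>\<^bsub>E\<^esub> e) \<in> \<Union>C" if "r \<in> carrier R" "(x, e) \<in> \<Union>C" for r x e
          using that CP unfolding P_def by blast
        show "(x \<oplus>\<^bsub>B\<^esub> y, e \<oplus>\<^bsub>E\<^esub> d) \<in> \<Union>C" if xy: "(x, e) \<in> \<Union>C \<and> (y, d) \<in> \<Union>C" for x e y d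
        proof -
          obtain G H where GH: "G \<in> C" "H \<in> C" "(x, e) \<in> G" "(y, d) \<in> H" using xy by blast
          then obtain K where "K \<in> C" "(x, e) \<in> K" "(y, d) \<in> K" using tot[of G H] by blast
          then show ?thesis using CP[of K] unfolding P_def by blast
        qed
      qed
      then show "\<Union>C \<in> Collect P" by simp
    qed
    then obtain G where PG: "P G" and max: "\<And>H. P H \<Longrightarrow> G \<subseteq> H \<Longrightarrow> H = G" by blast
    have Gc: "(x, e) \<in> G \<Longrightarrow> x \<in> carrier B \<and> e \<in> carrier E"
      and G0: "(\<zero>\<^bsub>B\<^esub>, e) \<in> G \<Longrightarrow> e = \<zero>\<^bsub>E\<^esub>"
      and Gadd: "(x, e) \<in> G \<Longrightarrow> (y, d) \<in> G \<Longrightarrow> (x \<oplus>\<^bsub>B\<^esub> y, e \<oplus>\<^bsub>E\<^esub> d) \<in> G"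
      and Gsm: "r \<in> carrier R \<Longrightarrow> (x, e) \<in> G \<Longrightarrow> (r \<odot>\<^bsub>B\<^esub> x, r \<odot>\<^bsub>E\<^esub> e) \<in> G" for x e y d r
      using PG unfolding P_def by blast+
    have Gbase: "base \<subseteq> G" using PG unfolding P_def by blast
    have Gneg: "(\<ominus>\<^bsub>B\<^esub> x, \<ominus>\<^bsub>E\<^esub> e) \<in> G" if "(x, e) \<in> G" for x e
      using Gsm[of "\<ominus>\<^bsub>R\<^esub> \<one>\<^bsub>R\<^esub>" x e] that Gc[OF that] by (simp add: B.smult_l_minus E.smult_l_minus)
    have Gzz: "(\<zero>\<^bsub>B\<^esub>, \<zero>\<^bsub>E\<^esub>) \<in> G"
      proof -
      have "(i \<zero>\<^bsub>A\<^esub>, f \<zero>\<^bsub>A\<^esub>) \<in> base" unfolding base_def using A.zero_closed by blast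
      then show ?thesis using Gbase i0 f0 by auto
    qed
    have Guniq: "e = d" if "(x, e) \<in> G" "(x, d) \<in> G" for x e d
    proof -
      have "(x \<oplus>\<^bsub>B\<^esub> \<ominus>\<^bsub>B\<^esub> x, e \<oplus>\<^bsub>E\<^esub> \<ominus>\<^bsub>E\<^esub> d) \<in> G" using Gadd Gneg that by blast
      then have "e \<oplus>\<^bsub>E\<^esub> \<ominus>\<^bsub>E\<^esub> d = \<zero>\<^bsub>E\<^esub>" using G0 Gc[OF that(1)] by (simp add: B.r_neg)
      then show ?thesis
        using E.M.minus_equality[of e "\<ominus>\<^bsub>E\<^esub> d"] Gc[OF that(1)] Gc[OF that(2)] by simp
    qed
    have dom: "\<exists>e. (b, e) \<in> G" if b: "b \<in> carrier B" for b
    proof -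
      define I where "I = {r \<in> carrier R. \<exists>e. (r \<odot>\<^bsub>B\<^esub> b, e) \<in> G}"
      define h where "h r = (THE e. (r \<odot>\<^bsub>B\<^esub> b, e) \<in> G)" for r
      have hI: "h r = e" if "(r \<odot>\<^bsub>B\<^esub> b, e) \<in> G" for r e
        unfolding h_def by (rule the_equality, rule that, rule Guniq[OF _ that])
      have hG: "(r \<odot>\<^bsub>B\<^esub> b, h r) \<in> G" if r: "r \<in> I" for r
      proof -
        obtain e where "(r \<odot>\<^bsub>B\<^esub> b, e) \<in> G" using r by (auto simp: I_def)
        then show ?thesis using hI by simp
      qed
      have Iadd: "r \<oplus>\<^bsub>R\<^esub> s \<in> I \<and> h (r \<oplus>\<^bsub>R\<^esub> s) = h r \<oplus>\<^bsub>E\<^esub> h s" if "r \<in> I" "s \<in> I" for r s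
      proof -
        have rs: "r \<in> carrier R" "s \<in> carrier R" using that by (auto simp: I_def)
        have "((r \<oplus>\<^bsub>R\<^esub> s) \<odot>\<^bsub>B\<^esub> b, h r \<oplus>\<^bsub>E\<^esub> h s) \<in> G"
          using Gadd[OF hG hG] that rs b by (simp add: B.smult_l_distr)
        then show ?thesis using hI rs by (auto simp: I_def)
      qed
      have Ism: "r \<otimes>\<^bsub>R\<^esub> s \<in> I \<and> h (r \<otimes>\<^bsub>R\<^esub> s) = r \<odot>\<^bsub>E\<^esub> h s" if "r \<in> carrier R" "s \<in> I" for r s
      proof -
        have rs: "s \<in> carrier R" using that by (auto simp: I_def)
        have "((r \<otimes>\<^bsub>R\<^esub> s) \<odot>\<^bsub>B\<^esub> b, r \<odot>\<^bsub>E\<^esub> h s) \<in> G"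
          using Gsm[OF _ hG] that rs b by (simp add: B.smult_assoc1)
        then show ?thesis using hI rs that by (auto simp: I_def)
      qed
      have I0: "\<zero>\<^bsub>R\<^esub> \<in> I" using Gzz b by (auto simp: I_def)
      have Ic: "I \<subseteq> carrier R" by (auto simp: I_def)
      have Ineg: "\<ominus>\<^bsub>R\<^esub> r \<in> I" if "r \<in> I" for r
        using Ism[of "\<ominus>\<^bsub>R\<^esub> \<one>\<^bsub>R\<^esub>" r] that Ic by (auto simp: R.l_minus subset_iff)
      have idl: "ideal I R"
      proof (rule idealI)
        show "ring R" by (rule R.ring_axioms)
        show "subgroup I (add_monoid R)"
          using Ic I0 Iadd Ineg by (intro subgroup.intro) (auto simp: a_inv_def[symmetric])
        show "x \<otimes>\<^bsub>R\<^esub> a \<in> I" if "a \<in> I" "x \<in> carrier R" for a x using Ism that by blast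
        show "a \<otimes>\<^bsub>R\<^esub> x \<in> I" if "a \<in> I" "x \<in> carrier R" for a x
          using Ism[of x a] that Ic by (metis R.m_comm subsetD)
      qed
      let ?I = "(ring_module R)\<lparr>carrier := I\<rparr>" and ?R = "(ring_module R)\<lparr>carrier := carrier R\<rparr>"
      have modI: "module R ?I" "module R ?R"
        using ideal_module[OF R.is_cring] idl R.oneideal by blast+
      have homI: "(\<lambda>r. r) \<in> mod_hom R ?I ?R" "inj_on (\<lambda>r. r) (carrier ?I)" "h \<in> mod_hom R ?I E"
        using Ic Iadd Ism Gc[OF hG] by (auto simp: mod_hom_def ring_module_def)
      obtain k where k: "k \<in> mod_hom R ?R E" and "\<And>r. r \<in> carrier ?I \<Longrightarrow> k r = h r"
        by (rule injective_module_lift[OF inj modI homI]) blast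
      then have kh: "\<And>r. r \<in> I \<Longrightarrow> k r = h r" by simp
      define e0 where "e0 = k \<one>\<^bsub>R\<^esub>"
      have e0: "e0 \<in> carrier E" using mod_homD(1)[OF k] by (simp add: e0_def)
      have he0: "h r = r \<odot>\<^bsub>E\<^esub> e0" if "r \<in> I" for r
        using mod_homD(3)[OF k, of r "\<one>\<^bsub>R\<^esub>"] kh that Ic by (auto simp: ring_module_def e0_def)
      define H where "H = {(y \<oplus>\<^bsub>B\<^esub> r \<odot>\<^bsub>B\<^esub> b, e \<oplus>\<^bsub>E\<^esub> r \<odot>\<^bsub>E\<^esub> e0) | y e r. (y, e) \<in> G \<and> r \<in> carrier R}"
      have GH: "G \<subseteq> H"
      proof
        fix p assume p: "p \<in> G"
        obtain y e where [simp]: "p = (y, e)" by (cases p)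
        have "p = (y \<oplus>\<^bsub>B\<^esub> \<zero>\<^bsub>R\<^esub> \<odot>\<^bsub>B\<^esub> b, e \<oplus>\<^bsub>E\<^esub> \<zero>\<^bsub>R\<^esub> \<odot>\<^bsub>E\<^esub> e0)" using p Gc b e0 by simp
        then show "p \<in> H" using p unfolding H_def by auto
      qed
      have "P H"
        unfolding P_def
      proof (intro conjI allI impI ballI)
        show "H \<subseteq> carrier B \<times> carrier E" using Gc b e0 by (auto simp: H_def)
        show "base \<subseteq> H" using Gbase GH by blast
        show "e = \<zero>\<^bsub>E\<^esub>" if "(\<zero>\<^bsub>B\<^esub>, e) \<in> H" for e
        proof -
          obtain y d r where 1: "(y, d) \<in> G" "r \<in> carrier R" "y \<oplus>\<^bsub>B\<^esub> r \<odot>\<^bsub>B\<^esub> b = \<zero>\<^bsub>B\<^esub>"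
            "e = d \<oplus>\<^bsub>E\<^esub> r \<odot>\<^bsub>E\<^esub> e0" using \<open>(\<zero>\<^bsub>B\<^esub>, e) \<in> H\<close> by (auto simp: H_def)
          note c = Gc[OF 1(1)]
          have "r \<odot>\<^bsub>B\<^esub> b = \<ominus>\<^bsub>B\<^esub> y"
            using 1 c b by (metis B.M.minus_equality B.M.minus_minus B.smult_closed)
          then have 2: "(r \<odot>\<^bsub>B\<^esub> b, \<ominus>\<^bsub>E\<^esub> d) \<in> G" using Gneg[OF 1(1)] by simp
          then have "r \<in> I" "h r = \<ominus>\<^bsub>E\<^esub> d" using hI 1 by (auto simp: I_def)
          then show ?thesis using he0[of r] 1(4) c by (simp add: E.M.r_neg)
        qed
        show "(x \<oplus>\<^bsub>B\<^esub> y, e \<oplus>\<^bsub>E\<^esub> d) \<in> H" if xy: "(x, e) \<in> H \<and> (y, d) \<in> H" for x e y d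
        proof -
          obtain x' e' r y' d' s where 1: "(x', e') \<in> G" "(y', d') \<in> G" "r \<in> carrier R" "s \<in> carrier R"
            "x = x' \<oplus>\<^bsub>B\<^esub> r \<odot>\<^bsub>B\<^esub> b" "e = e' \<oplus>\<^bsub>E\<^esub> r \<odot>\<^bsub>E\<^esub> e0"
            "y = y' \<oplus>\<^bsub>B\<^esub> s \<odot>\<^bsub>B\<^esub> b" "d = d' \<oplus>\<^bsub>E\<^esub> s \<odot>\<^bsub>E\<^esub> e0"
            using xy by (auto simp: H_def)
          note c = Gc[OF 1(1)] Gc[OF 1(2)]
          have "x \<oplus>\<^bsub>B\<^esub> y = (x' \<oplus>\<^bsub>B\<^esub> y') \<oplus>\<^bsub>B\<^esub> (r \<oplus>\<^bsub>R\<^esub> s) \<odot>\<^bsub>B\<^esub> b"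
            "e \<oplus>\<^bsub>E\<^esub> d = (e' \<oplus>\<^bsub>E\<^esub> d') \<oplus>\<^bsub>E\<^esub> (r \<oplus>\<^bsub>R\<^esub> s) \<odot>\<^bsub>E\<^esub> e0"
            using 1 c b e0 by (simp_all add: B.smult_l_distr E.smult_l_distr B.M.a_ac E.M.a_ac)
          moreover have "(x' \<oplus>\<^bsub>B\<^esub> y', e' \<oplus>\<^bsub>E\<^esub> d') \<in> G" using Gadd 1 by blast
          moreover have "r \<oplus>\<^bsub>R\<^esub> s \<in> carrier R" using 1 by simp
          ultimately show ?thesis unfolding H_def by blast
        qed
        show "(r \<odot>\<^bsub>B\<^esub> x, r \<odot>\<^bsub>E\<^esub> e) \<in> H" if r: "r \<in> carrier R" and xe: "(x, e) \<in> H" for r x e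
        proof -
          obtain x' e' s where 1: "(x', e') \<in> G" "s \<in> carrier R"
            "x = x' \<oplus>\<^bsub>B\<^esub> s \<odot>\<^bsub>B\<^esub> b" "e = e' \<oplus>\<^bsub>E\<^esub> s \<odot>\<^bsub>E\<^esub> e0"
            using xe by (auto simp: H_def)
          note c = Gc[OF 1(1)]
          have "r \<odot>\<^bsub>B\<^esub> x = r \<odot>\<^bsub>B\<^esub> x' \<oplus>\<^bsub>B\<^esub> (r \<otimes>\<^bsub>R\<^esub> s) \<odot>\<^bsub>B\<^esub> b"
            "r \<odot>\<^bsub>E\<^esub> e = r \<odot>\<^bsub>E\<^esub> e' \<oplus>\<^bsub>E\<^esub> (r \<otimes>\<^bsub>R\<^esub> s) \<odot>\<^bsub>E\<^esub> e0"
            using 1 c b e0 r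
            by (simp_all add: B.smult_r_distr E.smult_r_distr B.smult_assoc1 E.smult_assoc1)
          moreover have "(r \<odot>\<^bsub>B\<^esub> x', r \<odot>\<^bsub>E\<^esub> e') \<in> G" using Gsm 1 r by blast
          moreover have "r \<otimes>\<^bsub>R\<^esub> s \<in> carrier R" using 1 r by simp
          ultimately show ?thesis unfolding H_def by blast
        qed
      qed
      then have "H = G" using max GH by blast
      moreover have "(\<zero>\<^bsub>B\<^esub> \<oplus>\<^bsub>B\<^esub> \<one>\<^bsub>R\<^esub> \<odot>\<^bsub>B\<^esub> b, \<zero>\<^bsub>E\<^esub> \<oplus>\<^bsub>E\<^esub> \<one>\<^bsub>R\<^esub> \<odot>\<^bsub>E\<^esub> e0) \<in> H"
        using Gzz R.one_closed unfolding H_def by blast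
      ultimately show ?thesis using b by auto
    qed
    define g where "g x = (THE e. (x, e) \<in> G)" for x
    have gI: "g x = e" if "(x, e) \<in> G" for x e
      unfolding g_def by (rule the_equality, rule that, rule Guniq[OF _ that])
    have gG: "(x, g x) \<in> G" if "x \<in> carrier B" for x using dom[OF that] gI by auto
    show ?thesis
    proof (rule bexI[of _ g])
      show "\<forall>x\<in>carrier A. g (i x) = f x"
        using Gbase by (auto simp: base_def intro!: gI)
      show "g \<in> mod_hom R B E"
        using gG Gc gI Gadd Gsm by (auto simp: mod_hom_def)
    qed
  qed
  then show ?thesis using E unfolding injective_module_def by blast
qed

definition essential_hom ::
  "('a, 'z) ring_scheme \<Rightarrow> ('a, 'k, 'y) module_scheme \<Rightarrow> ('a, 'e, 'w) module_scheme
    \<Rightarrow> ('k \<Rightarrow> 'e) \<Rightarrow> bool"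
where
  "essential_hom R K E j \<longleftrightarrow> j \<in> mod_hom R K E \<and> inj_on j (carrier K) \<and>
     (\<forall>N. submodule N R E \<and> N \<inter> j ` carrier K = {\<zero>\<^bsub>E\<^esub>} \<longrightarrow> N = {\<zero>\<^bsub>E\<^esub>})"

definition injective_hull ::
  "('a, 'z) ring_scheme \<Rightarrow> ('a, 'k, 'y) module_scheme \<Rightarrow> ('a, 'e, 'w) module_scheme \<Rightarrow> bool"
where
  "injective_hull R K E \<longleftrightarrow>
     injective_module TYPE('a) R E \<and> (\<exists>j. essential_hom R K E j)"


section \<open>Matlis duality\<close>

text \<open>Throughout, \<open>E\<close> is the dualizing module, to be taken as the injective hull of the residue field.\<close>

abbreviation matlis_dual ::
  "('a, 'z) ring_scheme \<Rightarrow> ('a, 'e, 'y) module_scheme \<Rightarrow> ('a, 'm, 'w) module_scheme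
    \<Rightarrow> ('a, 'm \<Rightarrow> 'e) module"
where
  "matlis_dual R E M \<equiv> hom_module R M E"

definition dual_map ::
  "('a, 'm, 'w) module_scheme \<Rightarrow> ('m \<Rightarrow> 'n) \<Rightarrow> ('n \<Rightarrow> 'e) \<Rightarrow> ('m \<Rightarrow> 'e)"
where
  "dual_map M \<phi> g = (\<lambda>x\<in>carrier M. g (\<phi> x))"

definition biduality ::
  "('a, 'z) ring_scheme \<Rightarrow> ('a, 'e, 'y) module_scheme \<Rightarrow> ('a, 'm, 'w) module_scheme
    \<Rightarrow> 'm \<Rightarrow> ('m \<Rightarrow> 'e) \<Rightarrow> 'e"
where
  "biduality R E M x = (\<lambda>f\<in>carrier (matlis_dual R E M). f x)"

definition matlis_dualizable ::
  "('a, 'z) ring_scheme \<Rightarrow> ('a, 'e, 'y) module_scheme \<Rightarrow> ('a, 'm, 'w) module_scheme \<Rightarrow> bool"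
where
  "matlis_dualizable R E M \<longleftrightarrow> module R M \<and>
     biduality R E M \<in> mod_iso R M (matlis_dual R E (matlis_dual R E M))"


section \<open>Traces, module torsion and the smile dual\<close>

definition trace_sub ::
  "('a, 'z) ring_scheme \<Rightarrow> 'l set \<Rightarrow> ('a, 'l, 'y) module_scheme \<Rightarrow> ('a, 'n, 'w) module_scheme \<Rightarrow> 'n set"
where
  "trace_sub R S L N = submodule_span R N {f s | f s. f \<in> mod_hom R L N \<and> s \<in> S}"

definition module_torsion ::
  "('a, 'z) ring_scheme \<Rightarrow> 'l set \<Rightarrow> ('a, 'l, 'y) module_scheme \<Rightarrow> ('a, 'm, 'w) module_scheme \<Rightarrow> 'm set"
where
  "module_torsion R S L M =
     {z \<in> carrier M. \<forall>s\<in>S. pure_tensor R L M s z = \<zero>\<^bsub>tensor_product R L M\<^esub>}"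

text \<open>The smile dual of \<open>\<alpha>\<close> at \<open>M\<close> only involves the value of \<open>\<alpha>\<close> at the Matlis dual \<open>D\<close> of \<open>M\<close>.
  The dual of the projection \<open>D \<rightarrow> D / \<alpha> D\<close> lands in the double dual of \<open>M\<close>; the smile dual is
  its image, transported to \<open>M\<close> along the biduality map.\<close>

definition smile_dual ::
  "('a, 'z) ring_scheme \<Rightarrow> ('a, 'e, 'y) module_scheme \<Rightarrow> (('a, 'm \<Rightarrow> 'e) module \<Rightarrow> ('m \<Rightarrow> 'e) set)
    \<Rightarrow> ('a, 'm, 'w) module_scheme \<Rightarrow> 'm set"
where
  "smile_dual R E \<alpha> M =
     (let D = matlis_dual R E M; Q = quotient_module D (\<alpha> D) in
      {x \<in> carrier M. biduality R E M x \<in> dual_map D (\<lambda>f. \<alpha> D +>\<^bsub>D\<^esub> f) ` carrier (matlis_dual R E Q)})"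

end

theory Submission
  imports Defs
begin

text \<open>Bilinear maps \<open>L \<times> M \<rightarrow> E\<close> are at once the linear maps \<open>L \<rightarrow> M\<^sup>\<or>\<close> and the linear maps
  \<open>L \<otimes> M \<rightarrow> E\<close>. An element \<open>x\<close> of \<open>M\<close> lies in the smile dual of the trace iff evaluation at \<open>x\<close>
  kills \<open>f s\<close> for all \<open>f : L \<rightarrow> M\<^sup>\<or>\<close> and \<open>s \<in> S\<close>, that is, iff every linear map
  \<open>L \<otimes> M \<rightarrow> E\<close> kills \<open>s \<otimes> x\<close> for all \<open>s \<in> S\<close>. Since \<open>E\<close> is an injective cogenerator, this
  happens iff \<open>s \<otimes> x = 0\<close> for all \<open>s \<in> S\<close>.\<close>

section \<open>Submodules, quotients and linear maps\<close>

lemma (in abelian_group) a_minus_eq_zero_iff: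
  assumes "x \<in> carrier G" "y \<in> carrier G"
  shows "x \<ominus> y = \<zero> \<longleftrightarrow> x = y"
  using assms by (metis a_minus_def minus_equality minus_minus r_neg a_inv_closed)

lemma mod_hom_zero:
  assumes "module R M" "module R N" "f \<in> mod_hom R M N"
  shows "f \<zero>\<^bsub>M\<^esub> = \<zero>\<^bsub>N\<^esub>"
proof -
  interpret M: module R M by fact
  interpret N: module R N by fact
  show ?thesis
    using mod_homD(3)[OF assms(3), of "\<zero>\<^bsub>R\<^esub>" "\<zero>\<^bsub>M\<^esub>"] mod_homD(1)[OF assms(3), of "\<zero>\<^bsub>M\<^esub>"] by simp
qed

lemma mod_hom_minus:
  assumes "module R M" "module R N" "f \<in> mod_hom R M N" "x \<in> carrier M" "y \<in> carrier M"
  shows "f (x \<ominus>\<^bsub>M\<^esub> y) = f x \<ominus>\<^bsub>N\<^esub> f y"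
proof -
  interpret M: module R M by fact
  interpret N: module R N by fact
  note fD = mod_homD[OF assms(3)]
  have "f (\<ominus>\<^bsub>M\<^esub> y) = \<ominus>\<^bsub>N\<^esub> f y"
    using fD(3)[of "\<ominus>\<^bsub>R\<^esub> \<one>\<^bsub>R\<^esub>" y] fD(1)[of y] assms(5) by (simp add: M.smult_l_minus N.smult_l_minus)
  then show ?thesis
    using fD(2)[of x "\<ominus>\<^bsub>M\<^esub> y"] assms(4,5) by (simp add: a_minus_def)
qed

text \<open>Together with \<open>submodule_span_least\<close> this reduces the vanishing of a linear
  map on a span to its vanishing on generators. It is applied to the tensor relations and to the
  trace.\<close>

lemma kernel_submodule:
  assumes "module R M" "module R N" "f \<in> mod_hom R M N"
  shows "submodule {x \<in> carrier M. f x = \<zero>\<^bsub>N\<^esub>} R M"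
proof -
  interpret M: module R M by fact
  interpret N: module R N by fact
  note fD = mod_homD[OF assms(3)] and f0 = mod_hom_zero[OF assms]
  have "f (\<ominus>\<^bsub>M\<^esub> x) = \<ominus>\<^bsub>N\<^esub> f x" if "x \<in> carrier M" for x
    using mod_hom_minus[OF assms M.zero_closed that] f0 fD(1)[OF that] that by (simp add: a_minus_def)
  then show ?thesis
    by (intro M.submoduleI) (auto simp: f0 fD)
qed

text \<open>The hull is an intersection of submodules. The assumption
  \<open>A \<subseteq> carrier M\<close> makes \<open>carrier M\<close> itself a member of the
  family; over an empty family the intersection would be the whole type.\<close>

lemma submodule_span_submodule:
  assumes "module R M" "A \<subseteq> carrier M"
  shows "submodule (submodule_span R M A) R M"
proof -
  interpret M: module R M by fact
  note sub = M.submoduleE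
  have z: "\<zero>\<^bsub>M\<^esub> \<in> N" if "submodule N R M" for N
    using subgroup.one_closed[OF submodule.axioms(1)[OF that]] by simp
  have "submodule_span R M A \<subseteq> carrier M"
    unfolding submodule_span_def hull_def using M.carrier_is_submodule assms(2) by blast
  then show ?thesis
    unfolding submodule_span_def hull_def
    by (intro M.submoduleI) (auto intro: z sub)
qed

lemma submodule_span_least:
  assumes "submodule N R M" "A \<subseteq> N"
  shows "submodule_span R M A \<subseteq> N"
  unfolding submodule_span_def hull_def using assms by blast

lemma submodule_span_base: "A \<subseteq> submodule_span R M A"
  unfolding submodule_span_def by (rule hull_subset)

section \<open>Cosets and quotient modules\<close>

lemma submodule_abelian_subgroup:
  assumes "module R M" "submodule N R M"
  shows "abelian_subgroup N M"
proof -
  interpret M: module R M by fact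
  show ?thesis
    by (rule abelian_subgroupI3)
      (auto simp: additive_subgroup_def intro: submodule.axioms(1)[OF assms(2)] M.abelian_group_axioms)
qed

text \<open>Since \<open>N\<close> is the zero of the quotient, this is the test for a class to
  vanish. It serves the residue field, the tensor product and the quotient in the smile
  dual.\<close>

lemma coset_eq_submodule_iff:
  assumes "module R M" "submodule N R M" "x \<in> carrier M"
  shows "N +>\<^bsub>M\<^esub> x = N \<longleftrightarrow> x \<in> N"
proof -
  interpret N: abelian_subgroup N M using assms by (intro submodule_abelian_subgroup)
  show ?thesis using N.a_rcos_self[OF assms(3)] N.a_rcos_const by auto
qed

text \<open>The delicate law is homogeneity, because scalars act on a coset by a union over all its
  representatives. Two representatives differ by some n in \<open>N\<close>, and r n is again in
  \<open>N\<close>, so all cosets in the union coincide.\<close>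

lemma quotient_proj_hom:
  assumes "module R M" "submodule N R M"
  shows "(\<lambda>x. N +>\<^bsub>M\<^esub> x) \<in> mod_hom R M (quotient_module M N)"
proof -
  interpret M: module R M by fact
  interpret N: abelian_subgroup N M using assms by (intro submodule_abelian_subgroup)
  have "N +>\<^bsub>M\<^esub> (r \<odot>\<^bsub>M\<^esub> y) = N +>\<^bsub>M\<^esub> (r \<odot>\<^bsub>M\<^esub> x)"
    if r: "r \<in> carrier R" and x: "x \<in> carrier M" and y: "y \<in> N +>\<^bsub>M\<^esub> x" for r x y
  proof -
    obtain n where n: "n \<in> N" "y = n \<oplus>\<^bsub>M\<^esub> x" using y by (auto simp: a_r_coset_def')
    have rn: "r \<odot>\<^bsub>M\<^esub> n \<in> N" using M.submoduleE(4)[OF assms(2)] r n by blast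
    have "r \<odot>\<^bsub>M\<^esub> y = r \<odot>\<^bsub>M\<^esub> n \<oplus>\<^bsub>M\<^esub> r \<odot>\<^bsub>M\<^esub> x" using n r x by (simp add: M.smult_r_distr)
    then have "r \<odot>\<^bsub>M\<^esub> y \<in> N +>\<^bsub>M\<^esub> (r \<odot>\<^bsub>M\<^esub> x)" using rn by (auto simp: a_r_coset_def')
    then show ?thesis using r x by (metis N.a_repr_independence' M.smult_closed)
  qed
  then have "(\<Union>y\<in>N +>\<^bsub>M\<^esub> x. N +>\<^bsub>M\<^esub> (r \<odot>\<^bsub>M\<^esub> y)) = N +>\<^bsub>M\<^esub> (r \<odot>\<^bsub>M\<^esub> x)"
    if "r \<in> carrier R" "x \<in> carrier M" for r x
    using that N.a_rcos_self[OF that(2)] by blast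
  then show ?thesis
    using M.a_rcosetsI[OF N.a_subset] N.a_rcos_sum
    by (auto simp: mod_hom_def quotient_module_def)
qed

text \<open>This is the universal property of the quotient. The factor evaluates \<open>f\<close> at
  a chosen representative; the choice does not matter because representatives differ by elements of
  \<open>N\<close>, where \<open>f\<close> vanishes.\<close>

lemma quotient_hom_factor:
  assumes "module R M" "submodule N R M" "module R E" "f \<in> mod_hom R M E"
    and kills: "\<And>x. x \<in> N \<Longrightarrow> f x = \<zero>\<^bsub>E\<^esub>"
  obtains g where "g \<in> mod_hom R (quotient_module M N) E"
    and "\<And>x. x \<in> carrier M \<Longrightarrow> g (N +>\<^bsub>M\<^esub> x) = f x"
proof -
  interpret M: module R M by fact
  interpret E: module R E by fact
  interpret N: abelian_subgroup N M using assms by (intro submodule_abelian_subgroup)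
  note fD = mod_homD[OF assms(4)] and pD = mod_homD[OF quotient_proj_hom[OF assms(1,2)]]
  define g where "g C = f (SOME y. y \<in> C)" for C
  have g: "g (N +>\<^bsub>M\<^esub> x) = f x" if x: "x \<in> carrier M" for x
  proof -
    have "(SOME y. y \<in> N +>\<^bsub>M\<^esub> x) \<in> N +>\<^bsub>M\<^esub> x" using N.a_rcos_self[OF x] by (rule someI)
    then obtain n where n: "n \<in> N" "(SOME y. y \<in> N +>\<^bsub>M\<^esub> x) = n \<oplus>\<^bsub>M\<^esub> x" by (auto simp: a_r_coset_def')
    then show ?thesis using fD(1,2) x kills[OF n(1)] by (simp add: g_def)
  qed
  have "g \<in> mod_hom R (quotient_module M N) E"
    unfolding mod_hom_def
  proof (intro CollectI conjI ballI funcsetI)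
    have rep: "\<exists>x\<in>carrier M. C = N +>\<^bsub>M\<^esub> x" if "C \<in> carrier (quotient_module M N)" for C
      using that by (auto simp: quotient_module_def A_RCOSETS_def')
    fix C assume "C \<in> carrier (quotient_module M N)"
    then obtain x where x: "x \<in> carrier M" "C = N +>\<^bsub>M\<^esub> x" using rep by blast
    show "g C \<in> carrier E" using x g fD(1) by simp
    show "g (r \<odot>\<^bsub>quotient_module M N\<^esub> C) = r \<odot>\<^bsub>E\<^esub> g C" if "r \<in> carrier R" for r
      using that x g fD(3) pD(3) by (metis M.smult_closed)
    fix D assume "D \<in> carrier (quotient_module M N)"
    then obtain y where y: "y \<in> carrier M" "D = N +>\<^bsub>M\<^esub> y" using rep by blast
    show "g (C \<oplus>\<^bsub>quotient_module M N\<^esub> D) = g C \<oplus>\<^bsub>E\<^esub> g D"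
      using x y g fD(2) pD(2) by (metis M.add.m_closed)
  qed
  then show thesis using g that by blast
qed

section \<open>The Hom module\<close>

text \<open>Extensionality fixes all values off \<open>carrier M\<close>, so the module laws hold as
  equalities of functions. Commutativity of \<open>R\<close> makes a scalar multiple of a linear map
  linear.\<close>

lemma hom_module_module:
  assumes "module R M" "module R N"
  shows "module R (hom_module R M N)"
proof -
  interpret M: module R M by fact
  interpret N: module R N by fact
  show ?thesis
  proof (rule moduleI)
    show "cring R" by (rule M.R.is_cring)
    show "abelian_group (hom_module R M N)"
    proof (rule abelian_groupI)
      fix f assume f: "f \<in> carrier (hom_module R M N)"
      then have fc: "f x \<in> carrier N" if "x \<in> carrier M" for x
        using that by (auto simp: hom_module_def mod_hom_def)
      have "(\<lambda>x\<in>carrier M. \<ominus>\<^bsub>N\<^esub> f x) \<in> carrier (hom_module R M N)"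
        using f by (auto simp: hom_module_def mod_hom_def Pi_iff N.M.minus_add N.smult_r_minus)
      moreover have "(\<lambda>x\<in>carrier M. \<ominus>\<^bsub>N\<^esub> f x) \<oplus>\<^bsub>hom_module R M N\<^esub> f = \<zero>\<^bsub>hom_module R M N\<^esub>"
        using fc by (auto simp: hom_module_def N.M.l_neg fun_eq_iff)
      ultimately show "\<exists>g\<in>carrier (hom_module R M N). g \<oplus>\<^bsub>hom_module R M N\<^esub> f = \<zero>\<^bsub>hom_module R M N\<^esub>"
        by blast
    qed (auto simp: hom_module_def mod_hom_def N.M.a_ac N.smult_r_distr fun_eq_iff
        extensional_def Pi_iff)
  qed (auto simp: hom_module_def mod_hom_def N.M.a_ac N.smult_r_distr N.smult_l_distr fun_eq_iff
      extensional_def Pi_iff N.smult_assoc1[symmetric] M.R.m_comm)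
qed

section \<open>The residue field and cogeneration\<close>

text \<open>Zorn's lemma is applied to the proper ideals above \<open>I\<close>. In a Noetherian
  ring the union of a nonempty chain of ideals belongs to the chain, so it is at once a proper ideal
  containing \<open>I\<close>.\<close>

lemma (in noetherian_ring) proper_ideal_in_maximal:
  assumes "ideal I R" "I \<noteq> carrier R"
  obtains J where "maximalideal J R" "I \<subseteq> J"
proof -
  define P where "P = {J. ideal J R \<and> J \<noteq> carrier R \<and> I \<subseteq> J}"
  have "\<exists>J\<in>P. \<forall>K\<in>P. J \<subseteq> K \<longrightarrow> K = J"
  proof (rule subset_Zorn_nonempty)
    show "P \<noteq> {}" using assms by (auto simp: P_def)
    fix C assume C: "C \<noteq> {}" "subset.chain P C"
    then have "subset.chain {J. ideal J R} C" by (auto simp: subset_chain_def P_def)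
    then have "\<Union>C \<in> C" using C ideal_chain_is_trivial by blast
    then show "\<Union>C \<in> P" using C by (auto simp: subset_chain_def)
  qed
  then obtain J where J: "J \<in> P" and max: "\<And>K. K \<in> P \<Longrightarrow> J \<subseteq> K \<Longrightarrow> K = J" by blast
  have "maximalideal J R"
  proof (rule maximalidealI)
    show "ideal J R" "carrier R \<noteq> J" using J by (auto simp: P_def)
    show "K = J \<or> K = carrier R" if "ideal K R" "J \<subseteq> K" "K \<subseteq> carrier R" for K
      using that J max[of K] by (auto simp: P_def)
  qed
  then show thesis using J that by (auto simp: P_def)
qed

lemma max_ideal_maximal:
  assumes "local_ring R"
  shows "maximalideal (max_ideal R) R"
  using assms theI'[of "\<lambda>I. maximalideal I R"] by (auto simp: local_ring_def max_ideal_def)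

text \<open>Some maximal ideal contains \<open>I\<close>, and in a local ring there is only one
  candidate.\<close>

lemma proper_ideal_subset_max_ideal:
  assumes "noetherian_ring R" "local_ring R" "ideal I R" "I \<noteq> carrier R"
  shows "I \<subseteq> max_ideal R"
  using noetherian_ring.proper_ideal_in_maximal[OF assms(1,3,4)] max_ideal_maximal[OF assms(2)] assms(2)
  unfolding local_ring_def by metis

lemma ring_module_module:
  assumes "cring R"
  shows "module R (ring_module R)"
  using ideal_module[OF assms ring.oneideal[OF cring.axioms(1)[OF assms]]]
  by (simp add: ring_module_def)

lemma ideal_submodule:
  assumes "cring R" "ideal I R"
  shows "submodule I R (ring_module R)"
proof (rule module.module_incl_imp_submodule[OF ring_module_module[OF assms(1)]])
  show "I \<subseteq> carrier (ring_module R)"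
    using ideal.Icarr[OF assms(2)] by (auto simp: ring_module_def)
qed (rule ideal_module[OF assms])

text \<open>The map \<open>h\<close> is the composite of the projection of R onto R/m with
  \<open>j\<close>; its kernel is m because \<open>j\<close> is injective. It is the source of
  nonzero values in \<open>E\<close> when elements are separated from submodules.\<close>

lemma residue_field_hom:
  assumes "local_ring R" "module R E" "essential_hom R (residue_field R) E j"
  obtains h where "h \<in> mod_hom R (ring_module R) E"
    and "\<And>r. r \<in> carrier R \<Longrightarrow> h r = \<zero>\<^bsub>E\<^esub> \<longleftrightarrow> r \<in> max_ideal R"
proof -
  let ?m = "max_ideal R" and ?R = "ring_module R"
  interpret E: module R E by fact
  have R: "cring R" using assms(1) by (simp add: local_ring_def)
  have id: "ideal ?m R" using max_ideal_maximal[OF assms(1)] by (rule maximalideal.axioms(1))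
  note mR = ring_module_module[OF R] and sub = ideal_submodule[OF R id]
  have j: "j \<in> mod_hom R (residue_field R) E" "inj_on j (carrier (residue_field R))"
    using assms(3) by (auto simp: essential_hom_def)
  define h where "h r = j (?m +>\<^bsub>?R\<^esub> r)" for r
  note pD = mod_homD[OF quotient_proj_hom[OF mR sub], folded residue_field_def]
  note jD = mod_homD[OF j(1)]
  interpret RM: module R ?R by fact
  have "h \<in> mod_hom R ?R E"
    unfolding mod_hom_def h_def using pD(1) by (auto simp: pD(2,3) jD)
  moreover have "h r = \<zero>\<^bsub>E\<^esub> \<longleftrightarrow> r \<in> ?m" if "r \<in> carrier R" for r
  proof -
    have r: "r \<in> carrier ?R" using that by (simp add: ring_module_def)
    have "h \<zero>\<^bsub>?R\<^esub> = \<zero>\<^bsub>E\<^esub>" using \<open>h \<in> mod_hom R ?R E\<close> mR E.module_axioms by (intro mod_hom_zero)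
    moreover have "?m +>\<^bsub>?R\<^esub> \<zero>\<^bsub>?R\<^esub> = ?m"
      using coset_eq_submodule_iff[OF mR sub RM.M.zero_closed] subgroup.one_closed[OF submodule.axioms(1)[OF sub]]
      by simp
    ultimately have "h r = \<zero>\<^bsub>E\<^esub> \<longleftrightarrow> ?m +>\<^bsub>?R\<^esub> r = ?m"
      using pD(1)[OF r] pD(1)[OF RM.M.zero_closed] j(2) unfolding h_def by (metis inj_on_eq_iff)
    then show ?thesis using coset_eq_submodule_iff[OF mR sub r] by simp
  qed
  ultimately show thesis using that by blast
qed

text \<open>The ideal \<open>(N : t)\<close> is proper, hence contained in the maximal ideal, so that
  \<open>n + r t \<mapsto> r mod m\<close> is well defined on \<open>N + R t\<close>; it extends to \<open>F\<close> by injectivity.\<close>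

lemma injective_hull_separates:
  assumes noeth: "noetherian_ring R" and loc: "local_ring R"
    and hull: "injective_hull R (residue_field R) E"
    and F: "module R (F :: ('a, 'f) module)" and N: "submodule N R F"
    and t: "t \<in> carrier F" "t \<notin> N"
  obtains \<phi> where "\<phi> \<in> mod_hom R F E" "\<And>x. x \<in> N \<Longrightarrow> \<phi> x = \<zero>\<^bsub>E\<^esub>" "\<phi> t \<noteq> \<zero>\<^bsub>E\<^esub>"
proof -
  interpret F: module R F by fact
  obtain j where injE: "injective_module TYPE('a) R E" and j: "essential_hom R (residue_field R) E j"
    using hull by (auto simp: injective_hull_def)
  then have E: "module R E" by (simp add: injective_module_def)
  interpret E: module R E by fact
  interpret N: abelian_subgroup N F using F N by (rule submodule_abelian_subgroup)
  note Nsm = F.submoduleE(4)[OF N]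
  obtain h where h: "h \<in> mod_hom R (ring_module R) E"
    and hz: "\<And>r. r \<in> carrier R \<Longrightarrow> h r = \<zero>\<^bsub>E\<^esub> \<longleftrightarrow> r \<in> max_ideal R"
    using residue_field_hom[OF loc E j] by blast
  have hD: "h r \<in> carrier E" "h (r \<oplus>\<^bsub>R\<^esub> s) = h r \<oplus>\<^bsub>E\<^esub> h s" "h (r \<otimes>\<^bsub>R\<^esub> s) = r \<odot>\<^bsub>E\<^esub> h s"
    if "r \<in> carrier R" "s \<in> carrier R" for r s
    using mod_homD[OF h] that by (simp_all add: ring_module_def)
  have mx: "ideal (max_ideal R) R" "carrier R \<noteq> max_ideal R"
    using max_ideal_maximal[OF loc] by (auto simp: maximalideal_def maximalideal_axioms_def)
  have one: "\<one>\<^bsub>R\<^esub> \<notin> max_ideal R" using mx ideal.one_imp_carrier by blast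
  define I where "I = {r \<in> carrier R. r \<odot>\<^bsub>F\<^esub> t \<in> N}"
  have "ideal I R"
  proof (rule idealI)
    show "subgroup I (add_monoid R)"
      using t by (intro subgroup.intro)
        (auto simp: I_def F.smult_l_distr F.smult_l_minus a_inv_def[symmetric])
    show "x \<otimes>\<^bsub>R\<^esub> a \<in> I" if "a \<in> I" "x \<in> carrier R" for a x
      using that t Nsm by (auto simp: I_def F.smult_assoc1)
    then show "a \<otimes>\<^bsub>R\<^esub> x \<in> I" if "a \<in> I" "x \<in> carrier R" for a x
      using that F.R.m_comm[of a x] by (auto simp: I_def)
  qed (rule F.R.ring_axioms)
  moreover have "\<one>\<^bsub>R\<^esub> \<notin> I" using t by (simp add: I_def)
  then have "I \<noteq> carrier R" using F.R.one_closed by blast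
  ultimately have Im: "I \<subseteq> max_ideal R" using proper_ideal_subset_max_ideal noeth loc by blast
  define A where "A = {n \<oplus>\<^bsub>F\<^esub> r \<odot>\<^bsub>F\<^esub> t | n r. n \<in> N \<and> r \<in> carrier R}"
  have AI: "n \<oplus>\<^bsub>F\<^esub> r \<odot>\<^bsub>F\<^esub> t \<in> A" if "n \<in> N" "r \<in> carrier R" for n r
    using that by (auto simp: A_def)
  \<comment> \<open>The normal forms of sums and of scalar multiples (\<open>sm\<close>) serve
    twice: for the closure of \<open>A\<close> and for the linearity of \<open>f\<close> on
    \<open>A\<close>.\<close>
  have add: "(n \<oplus>\<^bsub>F\<^esub> r \<odot>\<^bsub>F\<^esub> t) \<oplus>\<^bsub>F\<^esub> (n' \<oplus>\<^bsub>F\<^esub> s \<odot>\<^bsub>F\<^esub> t) = (n \<oplus>\<^bsub>F\<^esub> n') \<oplus>\<^bsub>F\<^esub> (r \<oplus>\<^bsub>R\<^esub> s) \<odot>\<^bsub>F\<^esub> t"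
    if "n \<in> N" "n' \<in> N" "r \<in> carrier R" "s \<in> carrier R" for n n' r s
    using that t by (simp add: F.smult_l_distr F.M.a_ac)
  have sm: "s \<odot>\<^bsub>F\<^esub> (n \<oplus>\<^bsub>F\<^esub> r \<odot>\<^bsub>F\<^esub> t) = s \<odot>\<^bsub>F\<^esub> n \<oplus>\<^bsub>F\<^esub> (s \<otimes>\<^bsub>R\<^esub> r) \<odot>\<^bsub>F\<^esub> t"
    if "n \<in> N" "r \<in> carrier R" "s \<in> carrier R" for n r s
    using that t by (simp add: F.smult_r_distr F.smult_assoc1)
  have "submodule A R F"
  proof (rule F.submoduleI)
    show sub: "A \<subseteq> carrier F" using t by (auto simp: A_def)
    show "\<zero>\<^bsub>F\<^esub> \<in> A" using AI[of "\<zero>\<^bsub>F\<^esub>" "\<zero>\<^bsub>R\<^esub>"] t by simp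
    show "a \<oplus>\<^bsub>F\<^esub> b \<in> A" if "a \<in> A" "b \<in> A" for a b
      using that add AI by (auto simp: A_def)
    show smA: "s \<odot>\<^bsub>F\<^esub> a \<in> A" if "s \<in> carrier R" "a \<in> A" for s a
      using that sm AI Nsm unfolding A_def by clarsimp
    show "\<ominus>\<^bsub>F\<^esub> a \<in> A" if "a \<in> A" for a
      using smA[of "\<ominus>\<^bsub>R\<^esub> \<one>\<^bsub>R\<^esub>" a] that sub by (auto simp: F.smult_l_minus)
  qed
  then have A: "module R (F\<lparr>carrier := A\<rparr>)" using F by (rule submodule.submodule_is_module)
  \<comment> \<open>If n + r t = n' + s t, then (r - s) t lies in \<open>N\<close>, so r - s lies in
    \<open>I\<close> and hence in m, where \<open>h\<close> vanishes.\<close>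
  have uniq: "h r = h s"
    if eq: "n \<oplus>\<^bsub>F\<^esub> r \<odot>\<^bsub>F\<^esub> t = n' \<oplus>\<^bsub>F\<^esub> s \<odot>\<^bsub>F\<^esub> t" and mem: "n \<in> N" "n' \<in> N" "r \<in> carrier R" "s \<in> carrier R"
    for n n' r s
  proof -
    have "n' \<ominus>\<^bsub>F\<^esub> n = (r \<ominus>\<^bsub>R\<^esub> s) \<odot>\<^bsub>F\<^esub> t"
    proof -
      have "n' = (n' \<oplus>\<^bsub>F\<^esub> s \<odot>\<^bsub>F\<^esub> t) \<ominus>\<^bsub>F\<^esub> s \<odot>\<^bsub>F\<^esub> t" using mem t
        by (simp add: a_minus_def F.M.a_assoc F.M.r_neg)
      also have "\<dots> = (n \<oplus>\<^bsub>F\<^esub> r \<odot>\<^bsub>F\<^esub> t) \<ominus>\<^bsub>F\<^esub> s \<odot>\<^bsub>F\<^esub> t" by (simp add: eq)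
      also have "\<dots> = n \<oplus>\<^bsub>F\<^esub> (r \<ominus>\<^bsub>R\<^esub> s) \<odot>\<^bsub>F\<^esub> t" using mem t
        by (simp add: a_minus_def F.smult_l_distr F.smult_l_minus F.M.a_assoc)
      finally have 1: "n' = n \<oplus>\<^bsub>F\<^esub> (r \<ominus>\<^bsub>R\<^esub> s) \<odot>\<^bsub>F\<^esub> t" .
      have "(n \<oplus>\<^bsub>F\<^esub> (r \<ominus>\<^bsub>R\<^esub> s) \<odot>\<^bsub>F\<^esub> t) \<ominus>\<^bsub>F\<^esub> n = (r \<ominus>\<^bsub>R\<^esub> s) \<odot>\<^bsub>F\<^esub> t"
        using mem t by (simp add: a_minus_def F.M.a_ac F.M.r_neg1 F.M.r_neg2)
      then show ?thesis using 1 by simp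
    qed
    moreover have "n' \<ominus>\<^bsub>F\<^esub> n \<in> N" using mem by (simp add: a_minus_def)
    ultimately have "r \<ominus>\<^bsub>R\<^esub> s \<in> I" using mem by (simp add: I_def a_minus_def)
    then have "h (r \<ominus>\<^bsub>R\<^esub> s) = \<zero>\<^bsub>E\<^esub>" using Im hz I_def by blast
    moreover have "r = (r \<ominus>\<^bsub>R\<^esub> s) \<oplus>\<^bsub>R\<^esub> s" using mem by (simp add: a_minus_def F.R.a_assoc F.R.l_neg)
    ultimately show "h r = h s" using hD(2)[of "r \<ominus>\<^bsub>R\<^esub> s" s] hD(1)[of s s] mem by simp
  qed
  define f where "f a = (THE e. \<exists>n\<in>N. \<exists>r\<in>carrier R. a = n \<oplus>\<^bsub>F\<^esub> r \<odot>\<^bsub>F\<^esub> t \<and> e = h r)" for a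
  have f: "f (n \<oplus>\<^bsub>F\<^esub> r \<odot>\<^bsub>F\<^esub> t) = h r" if "n \<in> N" "r \<in> carrier R" for n r
    unfolding f_def
  proof (rule the_equality)
    show "\<exists>n'\<in>N. \<exists>s\<in>carrier R. n \<oplus>\<^bsub>F\<^esub> r \<odot>\<^bsub>F\<^esub> t = n' \<oplus>\<^bsub>F\<^esub> s \<odot>\<^bsub>F\<^esub> t \<and> h r = h s"
      using that by blast
  next
    fix e assume "\<exists>n'\<in>N. \<exists>s\<in>carrier R. n \<oplus>\<^bsub>F\<^esub> r \<odot>\<^bsub>F\<^esub> t = n' \<oplus>\<^bsub>F\<^esub> s \<odot>\<^bsub>F\<^esub> t \<and> e = h s"
    then obtain n' s where e: "n' \<in> N" "s \<in> carrier R"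
      "n \<oplus>\<^bsub>F\<^esub> r \<odot>\<^bsub>F\<^esub> t = n' \<oplus>\<^bsub>F\<^esub> s \<odot>\<^bsub>F\<^esub> t" "e = h s" by blast
    show "e = h r" using uniq[OF e(3) that(1) e(1) that(2) e(2)] e(4) by simp
  qed
  have fhom: "f \<in> mod_hom R (F\<lparr>carrier := A\<rparr>) E"
    unfolding mod_hom_def
  proof (intro CollectI conjI ballI funcsetI)
    fix a assume "a \<in> carrier (F\<lparr>carrier := A\<rparr>)"
    then obtain n r where a: "n \<in> N" "r \<in> carrier R" "a = n \<oplus>\<^bsub>F\<^esub> r \<odot>\<^bsub>F\<^esub> t" by (auto simp: A_def)
    show "f a \<in> carrier E" using a f hD by simp
    show "f (s \<odot>\<^bsub>F\<lparr>carrier := A\<rparr>\<^esub> a) = s \<odot>\<^bsub>E\<^esub> f a" if "s \<in> carrier R" for s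
      using that a f hD sm Nsm by simp
    fix b assume "b \<in> carrier (F\<lparr>carrier := A\<rparr>)"
    then obtain n' s where b: "n' \<in> N" "s \<in> carrier R" "b = n' \<oplus>\<^bsub>F\<^esub> s \<odot>\<^bsub>F\<^esub> t" by (auto simp: A_def)
    show "f (a \<oplus>\<^bsub>F\<lparr>carrier := A\<rparr>\<^esub> b) = f a \<oplus>\<^bsub>E\<^esub> f b"
      using a b f hD add by simp
  qed
  have incl: "(\<lambda>x. x) \<in> mod_hom R (F\<lparr>carrier := A\<rparr>) F" "inj_on (\<lambda>x. x) (carrier (F\<lparr>carrier := A\<rparr>))"
    using t by (auto simp: mod_hom_def A_def)
  \<comment> \<open>Injectivity is given over the type of ring elements;
    \<open>injective_module_universe\<close> carries it over to the type of
    \<open>F\<close>.\<close>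
  obtain \<phi> where \<phi>: "\<phi> \<in> mod_hom R F E" and ext: "\<And>x. x \<in> carrier (F\<lparr>carrier := A\<rparr>) \<Longrightarrow> \<phi> x = f x"
    using injective_module_lift[OF injective_module_universe[OF injE] A F incl fhom] by blast
  have val: "\<phi> (n \<oplus>\<^bsub>F\<^esub> r \<odot>\<^bsub>F\<^esub> t) = h r" if "n \<in> N" "r \<in> carrier R" for n r
    using ext AI[OF that] f[OF that] by simp
  \<comment> \<open>An element x of \<open>N\<close> is x + 0 t, and t is 0 + 1 t. The values are
    therefore h 0 = 0 and h 1, which is nonzero because 1 is not in m.\<close>
  show thesis
  proof (rule that[OF \<phi>])
    have "\<zero>\<^bsub>R\<^esub> \<in> max_ideal R"
      using mx(1) by (simp add: additive_subgroup.zero_closed ideal.axioms(1))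
    then show "\<phi> x = \<zero>\<^bsub>E\<^esub>" if "x \<in> N" for x using val[OF that F.R.zero_closed] hz[OF F.R.zero_closed] that t by simp
    show "\<phi> t \<noteq> \<zero>\<^bsub>E\<^esub>"
      using val[OF N.zero_closed F.R.one_closed] hz[OF F.R.one_closed] one t by simp
  qed
qed

section \<open>Free modules and bilinear maps\<close>

lemma free_module_module:
  assumes "cring R"
  shows "module R (free_module R B)"
proof -
  interpret cring R by fact
  let ?F = "free_module R B"
  have car: "c \<in> carrier ?F \<longleftrightarrow> (\<forall>x. c x \<in> carrier R) \<and> (\<forall>x. x \<notin> B \<longrightarrow> c x = \<zero>\<^bsub>R\<^esub>)
      \<and> finite {x. c x \<noteq> \<zero>\<^bsub>R\<^esub>}" for c by (simp add: free_module_def)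
  have addc: "c \<oplus>\<^bsub>?F\<^esub> d \<in> carrier ?F" if "c \<in> carrier ?F" "d \<in> carrier ?F" for c d
  proof -
    have "finite {x. c x \<oplus>\<^bsub>R\<^esub> d x \<noteq> \<zero>\<^bsub>R\<^esub>}"
      by (rule finite_subset[of _ "{x. c x \<noteq> \<zero>\<^bsub>R\<^esub>} \<union> {x. d x \<noteq> \<zero>\<^bsub>R\<^esub>}"]) (use that car in auto)
    then show ?thesis using that by (auto simp: free_module_def)
  qed
  have smc: "r \<odot>\<^bsub>?F\<^esub> c \<in> carrier ?F" if "r \<in> carrier R" "c \<in> carrier ?F" for r c
  proof -
    have "finite {x. r \<otimes>\<^bsub>R\<^esub> c x \<noteq> \<zero>\<^bsub>R\<^esub>}"
      by (rule finite_subset[of _ "{x. c x \<noteq> \<zero>\<^bsub>R\<^esub>}"]) (use that car in auto)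
    then show ?thesis using that by (auto simp: free_module_def)
  qed
  show ?thesis
  proof (rule moduleI)
    show "abelian_group ?F"
    proof (rule abelian_groupI)
      \<comment> \<open>The negative is formed as (-1) c, so that its finite support comes from
        \<open>smc\<close>.\<close>
      show "\<exists>d\<in>carrier ?F. d \<oplus>\<^bsub>?F\<^esub> c = \<zero>\<^bsub>?F\<^esub>" if c: "c \<in> carrier ?F" for c
        using smc[OF _ c, of "\<ominus>\<^bsub>R\<^esub> \<one>\<^bsub>R\<^esub>"] c
        by (intro bexI[of _ "(\<ominus>\<^bsub>R\<^esub> \<one>\<^bsub>R\<^esub>) \<odot>\<^bsub>?F\<^esub> c"]) (auto simp: free_module_def l_minus l_neg)
    qed (auto simp: addc, auto simp: free_module_def a_ac)
  qed (auto simp: smc is_cring, auto simp: free_module_def l_distr r_distr m_assoc)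
qed

lemma free_gen_closed:
  assumes "cring R" "x \<in> B"
  shows "free_gen R x \<in> carrier (free_module R B)"
proof -
  interpret cring R by fact
  have "finite {y. free_gen R x y \<noteq> \<zero>\<^bsub>R\<^esub>}"
    by (rule finite_subset[of _ "{x}"]) (auto simp: free_gen_def)
  then show ?thesis using assms(2) by (auto simp: free_module_def free_gen_def)
qed

lemma free_module_lift:
  assumes "module R E" "b \<in> B \<rightarrow> carrier E"
  obtains \<phi> where "\<phi> \<in> mod_hom R (free_module R B) E"
    and "\<And>x. x \<in> B \<Longrightarrow> \<phi> (free_gen R x) = b x"
proof -
  interpret E: module R E by fact
  let ?F = "free_module R B"
  let ?g = "\<lambda>c x. c x \<odot>\<^bsub>E\<^esub> b x" and ?s = "\<lambda>c. {x. c x \<noteq> \<zero>\<^bsub>R\<^esub>}"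
  define \<phi> where "\<phi> c = finsum E (?g c) (?s c)" for c
  interpret F: module R ?F using E.R.is_cring by (rule free_module_module)
  have b: "b x \<in> carrier E" if "x \<in> B" for x using assms(2) that by auto
  have car: "\<And>x. c x \<in> carrier R" "?s c \<subseteq> B" "finite (?s c)" if "c \<in> carrier ?F" for c
    using that by (auto simp: free_module_def)
  \<comment> \<open>Supports may shrink under addition and scaling. Summing over any finite set
    between the support and \<open>B\<close> lets both sides of each law be compared over one index
    set.\<close>
  have \<phi>: "\<phi> c = finsum E (?g c) T" if "finite T" "T \<subseteq> B" "?s c \<subseteq> T" "c \<in> carrier ?F" for c T
    unfolding \<phi>_def
    by (rule E.M.add.finprod_mono_neutral_cong_left) (use that car[OF that(4)] b in auto)
  show thesis
  proof
    show "\<phi> \<in> mod_hom R ?F E"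
      unfolding mod_hom_def
    proof (intro CollectI conjI ballI funcsetI)
      fix c assume c: "c \<in> carrier ?F"
      show "\<phi> c \<in> carrier E" unfolding \<phi>_def using car[OF c] b by (intro E.M.finsum_closed) auto
      show "\<phi> (r \<odot>\<^bsub>?F\<^esub> c) = r \<odot>\<^bsub>E\<^esub> \<phi> c" if r: "r \<in> carrier R" for r
      proof -
        have rc: "r \<odot>\<^bsub>?F\<^esub> c \<in> carrier ?F" using r c by simp
        have "\<phi> (r \<odot>\<^bsub>?F\<^esub> c) = finsum E (?g (r \<odot>\<^bsub>?F\<^esub> c)) (?s c)"
          by (rule \<phi>) (use car[OF c] rc r in \<open>auto simp: free_module_def\<close>)
        also have "\<dots> = finsum E (\<lambda>x. r \<odot>\<^bsub>E\<^esub> ?g c x) (?s c)"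
          by (rule E.M.finsum_cong') (use car[OF c] r b in \<open>auto simp: free_module_def E.smult_assoc1\<close>)
        also have "\<dots> = r \<odot>\<^bsub>E\<^esub> \<phi> c"
          unfolding \<phi>_def by (rule E.finsum_smult_ldistr[symmetric]) (use car[OF c] r b in auto)
        finally show ?thesis .
      qed
      fix d assume d: "d \<in> carrier ?F"
      let ?T = "?s c \<union> ?s d"
      have T: "finite ?T" "?T \<subseteq> B" using car[OF c] car[OF d] by auto
      have "\<phi> (c \<oplus>\<^bsub>?F\<^esub> d) = finsum E (?g (c \<oplus>\<^bsub>?F\<^esub> d)) ?T"
        by (rule \<phi>) (use T c d F.M.a_closed[OF c d] in \<open>auto simp: free_module_def\<close>)
      also have "\<dots> = finsum E (\<lambda>x. ?g c x \<oplus>\<^bsub>E\<^esub> ?g d x) ?T"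
      proof (rule E.M.finsum_cong')
        fix x assume "x \<in> ?T"
        then show "?g (c \<oplus>\<^bsub>?F\<^esub> d) x = ?g c x \<oplus>\<^bsub>E\<^esub> ?g d x"
          using T car[OF c] car[OF d] b by (auto simp: free_module_def E.smult_l_distr)
      qed (use T car[OF c] car[OF d] b in auto)
      also have "\<dots> = finsum E (?g c) ?T \<oplus>\<^bsub>E\<^esub> finsum E (?g d) ?T"
        by (rule E.M.finsum_addf) (use T car[OF c] car[OF d] b in auto)
      also have "\<dots> = \<phi> c \<oplus>\<^bsub>E\<^esub> \<phi> d"
        using \<phi>[OF T _ c] \<phi>[OF T _ d] by simp
      finally show "\<phi> (c \<oplus>\<^bsub>?F\<^esub> d) = \<phi> c \<oplus>\<^bsub>E\<^esub> \<phi> d" .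
    qed
    fix x assume x: "x \<in> B"
    \<comment> \<open>The singleton is used instead of the support, which would be empty if 1 = 0 in
      \<open>R\<close>.\<close>
    have "\<phi> (free_gen R x) = finsum E (?g (free_gen R x)) {x}"
      by (rule \<phi>) (use x free_gen_closed[OF E.R.is_cring x] in \<open>auto simp: free_gen_def\<close>)
    then show "\<phi> (free_gen R x) = b x" using b[OF x] by (simp add: free_gen_def)
  qed
qed

section \<open>Tensor relations and the adjunction between Hom and tensor product\<close>

lemma tensor_relationsI:
  fixes R (structure) and L M e F
  defines "F \<equiv> free_module R (carrier L \<times> carrier M)" and "e \<equiv> free_gen R"
  shows "\<lbrakk>l \<in> carrier L; l' \<in> carrier L; x \<in> carrier M\<rbrakk>
      \<Longrightarrow> e (l \<oplus>\<^bsub>L\<^esub> l', x) \<ominus>\<^bsub>F\<^esub> (e (l, x) \<oplus>\<^bsub>F\<^esub> e (l', x)) \<in> tensor_relations R L M"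
    and "\<lbrakk>l \<in> carrier L; x \<in> carrier M; x' \<in> carrier M\<rbrakk>
      \<Longrightarrow> e (l, x \<oplus>\<^bsub>M\<^esub> x') \<ominus>\<^bsub>F\<^esub> (e (l, x) \<oplus>\<^bsub>F\<^esub> e (l, x')) \<in> tensor_relations R L M"
    and "\<lbrakk>r \<in> carrier R; l \<in> carrier L; x \<in> carrier M\<rbrakk>
      \<Longrightarrow> e (r \<odot>\<^bsub>L\<^esub> l, x) \<ominus>\<^bsub>F\<^esub> r \<odot>\<^bsub>F\<^esub> e (l, x) \<in> tensor_relations R L M"
    and "\<lbrakk>r \<in> carrier R; l \<in> carrier L; x \<in> carrier M\<rbrakk>
      \<Longrightarrow> e (l, r \<odot>\<^bsub>M\<^esub> x) \<ominus>\<^bsub>F\<^esub> r \<odot>\<^bsub>F\<^esub> e (l, x) \<in> tensor_relations R L M"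
  unfolding tensor_relations_def Let_def F_def e_def by blast+

lemma tensor_relations_closed:
  assumes "module R L" "module R M"
  shows "tensor_relations R L M \<subseteq> carrier (free_module R (carrier L \<times> carrier M))"
proof -
  interpret L: module R L by fact
  interpret M: module R M by fact
  interpret F: module R "free_module R (carrier L \<times> carrier M)"
    using L.R.is_cring by (rule free_module_module)
  note gen = free_gen_closed[OF L.R.is_cring]
  show ?thesis unfolding tensor_relations_def Let_def by (auto simp: gen)
qed

lemma tensor_null_submodule:
  assumes "module R L" "module R M"
  shows "submodule (tensor_null R L M) R (free_module R (carrier L \<times> carrier M))"
  unfolding tensor_null_def
  using assms
  by (intro submodule_span_submodule free_module_module tensor_relations_closed module.axioms(1)[OF assms(1)])

lemma pure_tensor_zero_iff:
  assumes "module R L" "module R M" "l \<in> carrier L" "x \<in> carrier M"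
  shows "pure_tensor R L M l x = \<zero>\<^bsub>tensor_product R L M\<^esub>
    \<longleftrightarrow> free_gen R (l, x) \<in> tensor_null R L M"
proof -
  have R: "cring R" by (rule module.axioms(1)[OF assms(1)])
  show ?thesis
    using coset_eq_submodule_iff[OF free_module_module[OF R] tensor_null_submodule[OF assms(1,2)]
        free_gen_closed[OF R]] assms(3,4)
    by (simp add: pure_tensor_def tensor_product_def quotient_module_def)
qed

text \<open>One direction of the adjunction: the bilinear map sending (l, y) to \<open>f l y\<close>
  extends linearly to the free module. Bilinearity says exactly that the extension kills the tensor
  relations, so it kills their span.\<close>

lemma hom_dual_kills_pure_tensor_zero:
  assumes L: "module R L" and M: "module R M" and E: "module R E"
    and f: "f \<in> mod_hom R L (matlis_dual R E M)"
    and mem: "s \<in> carrier L" "x \<in> carrier M"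
    and null: "free_gen R (s, x) \<in> tensor_null R L M"
  shows "f s x = \<zero>\<^bsub>E\<^esub>"
proof -
  interpret L: module R L by fact
  interpret M: module R M by fact
  interpret E: module R E by fact
  let ?F = "free_module R (carrier L \<times> carrier M)"
  have R: "cring R" by (rule L.R.is_cring)
  note F = free_module_module[OF R, of "carrier L \<times> carrier M"]
  interpret F: module R ?F by (rule F)
  note fD = mod_homD[OF f]
  have fl: "f l \<in> mod_hom R M E" if "l \<in> carrier L" for l
    using fD(1)[OF that] by (simp add: hom_module_def)
  note flD = mod_homD[OF fl]
  have fa: "f (l \<oplus>\<^bsub>L\<^esub> l') y = f l y \<oplus>\<^bsub>E\<^esub> f l' y"
    if "l \<in> carrier L" "l' \<in> carrier L" "y \<in> carrier M" for l l' y
    using fD(2)[of l l'] that by (simp add: hom_module_def)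
  have fs: "f (r \<odot>\<^bsub>L\<^esub> l) y = r \<odot>\<^bsub>E\<^esub> f l y"
    if "r \<in> carrier R" "l \<in> carrier L" "y \<in> carrier M" for r l y
    using fD(3)[of r l] that by (simp add: hom_module_def)
  have "(\<lambda>(l, y). f l y) \<in> carrier L \<times> carrier M \<rightarrow> carrier E" using flD(1) by auto
  then obtain \<phi> where \<phi>: "\<phi> \<in> mod_hom R ?F E"
    and gen: "\<And>p. p \<in> carrier L \<times> carrier M \<Longrightarrow> \<phi> (free_gen R p) = (\<lambda>(l, y). f l y) p"
    by (rule free_module_lift[OF E]) blast
  have g: "\<phi> (free_gen R (l, y)) = f l y" if "l \<in> carrier L" "y \<in> carrier M" for l y
    using gen[of "(l, y)"] that by simp
  note \<phi>D = mod_homD[OF \<phi>] and \<phi>m = mod_hom_minus[OF F E \<phi>]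
  note gc = free_gen_closed[OF R, of _ "carrier L \<times> carrier M"]
  have "tensor_relations R L M \<subseteq> {c \<in> carrier ?F. \<phi> c = \<zero>\<^bsub>E\<^esub>}"
    unfolding tensor_relations_def Let_def
    by (auto simp: gc \<phi>m \<phi>D g fa fs flD E.M.a_minus_eq_zero_iff)
  then have "tensor_null R L M \<subseteq> {c \<in> carrier ?F. \<phi> c = \<zero>\<^bsub>E\<^esub>}"
    unfolding tensor_null_def by (rule submodule_span_least[OF kernel_submodule[OF F E \<phi>]])
  then show ?thesis using null g[OF mem] by auto
qed

text \<open>The converse direction, by currying: a linear map on the free module that kills
  \<open>tensor_null\<close> is bilinear on generators. The inner restriction makes each value
  extensional, as elements of the Matlis dual must be.\<close>

lemma hom_dual_of_tensor_hom:
  assumes L: "module R L" and M: "module R M" and E: "module R E"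
    and \<phi>: "\<phi> \<in> mod_hom R (free_module R (carrier L \<times> carrier M)) E"
    and null: "\<And>c. c \<in> tensor_null R L M \<Longrightarrow> \<phi> c = \<zero>\<^bsub>E\<^esub>"
  shows "(\<lambda>l. \<lambda>x\<in>carrier M. \<phi> (free_gen R (l, x))) \<in> mod_hom R L (matlis_dual R E M)"
proof -
  interpret L: module R L by fact
  interpret M: module R M by fact
  interpret E: module R E by fact
  let ?F = "free_module R (carrier L \<times> carrier M)" and ?e = "free_gen R"
  have R: "cring R" by (rule L.R.is_cring)
  note F = free_module_module[OF R, of "carrier L \<times> carrier M"]
  interpret F: module R ?F by (rule F)
  note \<phi>D = mod_homD[OF \<phi>] and \<phi>m = mod_hom_minus[OF F E \<phi>]
  note gc = free_gen_closed[OF R, of _ "carrier L \<times> carrier M"]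
  \<comment> \<open>Every relation is a difference c - d, so killing it identifies the two values.
    The four families of relations then become the four bilinearity laws below.\<close>
  have eq: "\<phi> c = \<phi> d"
    if "c \<ominus>\<^bsub>?F\<^esub> d \<in> tensor_relations R L M" "c \<in> carrier ?F" "d \<in> carrier ?F" for c d
  proof -
    have "\<phi> c \<ominus>\<^bsub>E\<^esub> \<phi> d = \<zero>\<^bsub>E\<^esub>"
      using null submodule_span_base \<phi>m[OF that(2,3)] that(1) unfolding tensor_null_def
      by (metis subsetD)
    then show ?thesis using \<phi>D(1) that by (simp add: E.M.a_minus_eq_zero_iff)
  qed
  have "\<phi> (?e (l \<oplus>\<^bsub>L\<^esub> l', x)) = \<phi> (?e (l, x)) \<oplus>\<^bsub>E\<^esub> \<phi> (?e (l', x))"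
    if "l \<in> carrier L" "l' \<in> carrier L" "x \<in> carrier M" for l l' x
  proof -
    have "\<phi> (?e (l \<oplus>\<^bsub>L\<^esub> l', x)) = \<phi> (?e (l, x) \<oplus>\<^bsub>?F\<^esub> ?e (l', x))"
      using that gc by (intro eq tensor_relationsI) auto
    then show ?thesis using that gc \<phi>D by simp
  qed
  moreover have "\<phi> (?e (l, x \<oplus>\<^bsub>M\<^esub> x')) = \<phi> (?e (l, x)) \<oplus>\<^bsub>E\<^esub> \<phi> (?e (l, x'))"
    if "l \<in> carrier L" "x' \<in> carrier M" "x \<in> carrier M" for l x x'
  proof -
    have "\<phi> (?e (l, x \<oplus>\<^bsub>M\<^esub> x')) = \<phi> (?e (l, x) \<oplus>\<^bsub>?F\<^esub> ?e (l, x'))"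
      using that gc by (intro eq tensor_relationsI) auto
    then show ?thesis using that gc \<phi>D by simp
  qed
  moreover have "\<phi> (?e (r \<odot>\<^bsub>L\<^esub> l, x)) = r \<odot>\<^bsub>E\<^esub> \<phi> (?e (l, x))"
    if "r \<in> carrier R" "l \<in> carrier L" "x \<in> carrier M" for r l x
  proof -
    have "\<phi> (?e (r \<odot>\<^bsub>L\<^esub> l, x)) = \<phi> (r \<odot>\<^bsub>?F\<^esub> ?e (l, x))"
      using that gc by (intro eq tensor_relationsI) auto
    then show ?thesis using that gc \<phi>D by simp
  qed
  moreover have "\<phi> (?e (l, r \<odot>\<^bsub>M\<^esub> x)) = r \<odot>\<^bsub>E\<^esub> \<phi> (?e (l, x))"
    if "r \<in> carrier R" "l \<in> carrier L" "x \<in> carrier M" for r l x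
  proof -
    have "\<phi> (?e (l, r \<odot>\<^bsub>M\<^esub> x)) = \<phi> (r \<odot>\<^bsub>?F\<^esub> ?e (l, x))"
      using that gc by (intro eq tensor_relationsI) auto
    then show ?thesis using that gc \<phi>D by simp
  qed
  ultimately show ?thesis
    using \<phi>D(1) gc by (auto simp: mod_hom_def hom_module_def fun_eq_iff)
qed

section \<open>The smile dual\<close>

text \<open>This is the functional that biduality attaches to x, before restriction to the carrier
  of the dual.\<close>

lemma evaluation_hom:
  assumes "x \<in> carrier M"
  shows "(\<lambda>f. f x) \<in> mod_hom R (matlis_dual R E M) E"
  using assms by (auto simp: mod_hom_def hom_module_def)

text \<open>A functional on the dual \<open>D\<close> factors through the quotient by
  \<open>\<alpha> D\<close> iff it vanishes on \<open>\<alpha> D\<close>. Applied to evaluation at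
  x, this exhibits the smile dual as the set of elements of M annihilated by
  \<open>\<alpha> D\<close>.\<close>

lemma mem_smile_dual_iff:
  fixes E :: "('a, 'e, 'u) module_scheme" and M :: "('a, 'm, 'w) module_scheme"
  assumes M: "module R M" and E: "module R E" and x: "x \<in> carrier M"
    and sub: "submodule (\<alpha> (matlis_dual R E M)) R (matlis_dual R E M)"
  shows "x \<in> smile_dual R E \<alpha> M \<longleftrightarrow> (\<forall>f\<in>\<alpha> (matlis_dual R E M). f x = \<zero>\<^bsub>E\<^esub>)"
proof -
  interpret E: module R E by fact
  define D where "D = matlis_dual R E M"
  define Q where "Q = quotient_module D (\<alpha> D)"
  have D: "module R D" unfolding D_def using M E by (rule hom_module_module)
  interpret D: module R D by fact
  have sub': "submodule (\<alpha> D) R D" using sub by (simp add: D_def)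
  note p = quotient_proj_hom[OF D sub', folded Q_def]
  have \<alpha>D: "\<alpha> D \<subseteq> carrier D" using D.submoduleE(1)[OF sub'] .
  have ev: "(\<lambda>f. f x) \<in> mod_hom R D E" unfolding D_def using x by (rule evaluation_hom)
  have "x \<in> smile_dual R E \<alpha> M \<longleftrightarrow>
      (\<exists>g\<in>carrier (matlis_dual R E Q). \<forall>f\<in>carrier D. f x = g (\<alpha> D +>\<^bsub>D\<^esub> f))"
    unfolding smile_dual_def Let_def D_def[symmetric] Q_def[symmetric]
    using x by (auto simp: image_iff biduality_def dual_map_def fun_eq_iff restrict_def D_def)
  also have "\<dots> \<longleftrightarrow> (\<forall>f\<in>\<alpha> D. f x = \<zero>\<^bsub>E\<^esub>)"
  proof
    assume "\<exists>g\<in>carrier (matlis_dual R E Q). \<forall>f\<in>carrier D. f x = g (\<alpha> D +>\<^bsub>D\<^esub> f)"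
    then obtain g where g: "\<And>f. f \<in> carrier D \<Longrightarrow> f x = g (\<alpha> D +>\<^bsub>D\<^esub> f)" by blast
    show "\<forall>f\<in>\<alpha> D. f x = \<zero>\<^bsub>E\<^esub>"
    proof
      fix f assume f: "f \<in> \<alpha> D"
      have z: "\<zero>\<^bsub>D\<^esub> \<in> \<alpha> D" using subgroup.one_closed[OF submodule.axioms(1)[OF sub']] by simp
      \<comment> \<open>As f and the zero of \<open>D\<close> share a coset, evaluation at x takes
        the same value on both; linearity of g is not invoked.\<close>
      have "\<alpha> D +>\<^bsub>D\<^esub> f = \<alpha> D +>\<^bsub>D\<^esub> \<zero>\<^bsub>D\<^esub>"
        using coset_eq_submodule_iff[OF D sub'] f z \<alpha>D by blast
      then have "f x = \<zero>\<^bsub>D\<^esub> x" using g f z \<alpha>D by (metis subsetD)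
      then show "f x = \<zero>\<^bsub>E\<^esub>" using mod_hom_zero[OF D E ev] by simp
    qed
  next
    assume "\<forall>f\<in>\<alpha> D. f x = \<zero>\<^bsub>E\<^esub>"
    then obtain g where g: "g \<in> mod_hom R Q E" "\<And>f. f \<in> carrier D \<Longrightarrow> g (\<alpha> D +>\<^bsub>D\<^esub> f) = f x"
      using quotient_hom_factor[OF D sub' E ev] unfolding Q_def by blast
    have pm: "\<And>f. f \<in> carrier D \<Longrightarrow> \<alpha> D +>\<^bsub>D\<^esub> f \<in> carrier Q" using mod_homD(1)[OF p] .
    \<comment> \<open>The map g must be restricted to \<open>carrier Q\<close> to become an element
      of the dual. Additivity and homogeneity survive the restriction because sums and multiples of
      cosets stay in \<open>carrier Q\<close>.\<close>
    have Qc: "C \<oplus>\<^bsub>Q\<^esub> C' \<in> carrier Q" "r \<in> carrier R \<Longrightarrow> r \<odot>\<^bsub>Q\<^esub> C \<in> carrier Q"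
      if CC: "C \<in> carrier Q" "C' \<in> carrier Q" for C C' r
    proof -
      obtain f f' where f: "f \<in> carrier D" "f' \<in> carrier D" "C = \<alpha> D +>\<^bsub>D\<^esub> f" "C' = \<alpha> D +>\<^bsub>D\<^esub> f'"
        using CC by (auto simp: Q_def quotient_module_def A_RCOSETS_def')
      show "C \<oplus>\<^bsub>Q\<^esub> C' \<in> carrier Q"
        using f mod_homD(2)[OF p, of f f'] pm[of "f \<oplus>\<^bsub>D\<^esub> f'"] by simp
      show "r \<odot>\<^bsub>Q\<^esub> C \<in> carrier Q" if "r \<in> carrier R"
        using f mod_homD(3)[OF p that f(1)] pm[of "r \<odot>\<^bsub>D\<^esub> f"] that by simp
    qed
    have "restrict g (carrier Q) \<in> carrier (matlis_dual R E Q)"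
      using g(1) Qc by (auto simp: hom_module_def mod_hom_def)
    moreover have "\<forall>f\<in>carrier D. f x = restrict g (carrier Q) (\<alpha> D +>\<^bsub>D\<^esub> f)"
      using g(2) pm by simp
    ultimately show "\<exists>g\<in>carrier (matlis_dual R E Q). \<forall>f\<in>carrier D. f x = g (\<alpha> D +>\<^bsub>D\<^esub> f)" by blast
  qed
  finally show ?thesis by (simp add: D_def)
qed

text \<open>Evaluation at x vanishes on the trace iff it vanishes on the generators
  \<open>f s\<close>, since its kernel is a submodule.\<close>

lemma mem_smile_dual_trace_iff:
  assumes M: "module R M" and E: "module R E" and x: "x \<in> carrier M" and S: "S \<subseteq> carrier L"
  shows "x \<in> smile_dual R E (trace_sub R S L) M \<longleftrightarrow>
    (\<forall>f\<in>mod_hom R L (matlis_dual R E M). \<forall>s\<in>S. f s x = \<zero>\<^bsub>E\<^esub>)"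
proof -
  let ?D = "matlis_dual R E M"
  let ?A = "{f s | f s. f \<in> mod_hom R L ?D \<and> s \<in> S}"
  have D: "module R ?D" using M E by (rule hom_module_module)
  have A: "?A \<subseteq> carrier ?D" using S by (auto dest: mod_homD(1))
  have "submodule (trace_sub R S L ?D) R ?D"
    unfolding trace_sub_def using D A by (rule submodule_span_submodule)
  then have "x \<in> smile_dual R E (trace_sub R S L) M \<longleftrightarrow> (\<forall>g\<in>trace_sub R S L ?D. g x = \<zero>\<^bsub>E\<^esub>)"
    using M E x by (intro mem_smile_dual_iff)
  also have "\<dots> \<longleftrightarrow> (\<forall>g\<in>?A. g x = \<zero>\<^bsub>E\<^esub>)"
  proof
    assume "\<forall>g\<in>?A. g x = \<zero>\<^bsub>E\<^esub>"
    then have "?A \<subseteq> {g \<in> carrier ?D. g x = \<zero>\<^bsub>E\<^esub>}" using A by blast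
    then have "trace_sub R S L ?D \<subseteq> {g \<in> carrier ?D. g x = \<zero>\<^bsub>E\<^esub>}"
      unfolding trace_sub_def
      by (rule submodule_span_least[OF kernel_submodule[OF D E evaluation_hom[OF x]]])
    then show "\<forall>g\<in>trace_sub R S L ?D. g x = \<zero>\<^bsub>E\<^esub>" by blast
  next
    assume "\<forall>g\<in>trace_sub R S L ?D. g x = \<zero>\<^bsub>E\<^esub>"
    then show "\<forall>g\<in>?A. g x = \<zero>\<^bsub>E\<^esub>"
      using submodule_span_base[of ?A R ?D] unfolding trace_sub_def by blast
  qed
  finally show ?thesis by blast
qed

section \<open>Comparison of the smile dual of the trace with module torsion\<close>

theorem theorem8p18:
  fixes R :: "('a, 'z) ring_scheme"
    and E :: "('a, 'e, 'u) module_scheme"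
    and L :: "('a, 'l, 'v) module_scheme"
    and S :: "'l set"
    and M :: "('a, 'm, 'w) module_scheme"
  assumes "noetherian_ring R" and "local_ring R" and "adic_complete R (max_ideal R)"
    and "injective_hull R (residue_field R) E"
    and "module R L" and "S \<subseteq> carrier L"
    and "matlis_dualizable R E M"
  shows "smile_dual R E (trace_sub R S L) M = module_torsion R S L M"
proof -
  let ?F = "free_module R (carrier L \<times> carrier M)"
  have M: "module R M" using assms(7) by (simp add: matlis_dualizable_def)
  have E: "module R E" using assms(4) by (simp add: injective_hull_def injective_module_def)
  have R: "cring R" by (rule module.axioms(1)[OF M])
  note L = assms(5)
  have iff: "(\<forall>f\<in>mod_hom R L (matlis_dual R E M). f s x = \<zero>\<^bsub>E\<^esub>) \<longleftrightarrow>
      pure_tensor R L M s x = \<zero>\<^bsub>tensor_product R L M\<^esub>"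
    if s: "s \<in> carrier L" and x: "x \<in> carrier M" for s x
    unfolding pure_tensor_zero_iff[OF L M s x]
  proof
    assume "free_gen R (s, x) \<in> tensor_null R L M"
    then show "\<forall>f\<in>mod_hom R L (matlis_dual R E M). f s x = \<zero>\<^bsub>E\<^esub>"
      using hom_dual_kills_pure_tensor_zero[OF L M E _ s x] by blast
  next
    assume kill: "\<forall>f\<in>mod_hom R L (matlis_dual R E M). f s x = \<zero>\<^bsub>E\<^esub>"
    show "free_gen R (s, x) \<in> tensor_null R L M"
    proof (rule ccontr)
      assume "free_gen R (s, x) \<notin> tensor_null R L M"
      moreover have "free_gen R (s, x) \<in> carrier ?F" using s x by (intro free_gen_closed R) auto
      \<comment> \<open>Separating the generator from \<open>tensor_null\<close> inside the free
        module amounts to separating the pure tensor from zero in the tensor product.\<close>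
      ultimately obtain \<phi> where \<phi>: "\<phi> \<in> mod_hom R ?F E" "\<And>c. c \<in> tensor_null R L M \<Longrightarrow> \<phi> c = \<zero>\<^bsub>E\<^esub>"
        "\<phi> (free_gen R (s, x)) \<noteq> \<zero>\<^bsub>E\<^esub>"
        using injective_hull_separates[OF assms(1,2,4) free_module_module[OF R] tensor_null_submodule[OF L M],
            of "free_gen R (s, x)"] by blast
      \<comment> \<open>Currying \<open>\<phi>\<close> gives a linear map from L to the dual of M
        whose value at s and x is \<open>\<phi> (free_gen R (s, x))\<close>, nonzero although
        \<open>kill\<close> makes it zero.\<close>
      show False
        using bspec[OF kill hom_dual_of_tensor_hom[OF L M E \<phi>(1,2)]] \<phi>(3) x by simp
    qed
  qed
  have "x \<in> smile_dual R E (trace_sub R S L) M \<longleftrightarrow> x \<in> module_torsion R S L M"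
    if x: "x \<in> carrier M" for x
    unfolding mem_smile_dual_trace_iff[OF M E x assms(6)] module_torsion_def
    using iff[OF subsetD[OF assms(6)] x] x by auto
  moreover have "smile_dual R E (trace_sub R S L) M \<subseteq> carrier M"
    by (auto simp: smile_dual_def Let_def)
  moreover have "module_torsion R S L M \<subseteq> carrier M"
    by (auto simp: module_torsion_def)
  ultimately show ?thesis by blast
qed

end
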